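(* Let $(X,\|\cdot\|)$ be a complex Banach space with open unit ball $B$, and let $h\in\mathrm{Hol}(B,X)$ be such that $h(0)=0$. Suppose that, for some $\omega\in\mathbb{R}$, the following holds: $$\mathrm{Ker}(\omega I-h'(0))\oplus\mathrm{Im}(\omega I-h'(0))=X.$$ Assume also that $\Phi_\alpha\in\mathrm{Hol}(B)$ for a certain $\alpha\in\mathbb{R}\setminus\{0\}$ such that $\alpha\omega\neq1$. Then the sequence $\{\Phi_\alpha^n\}_{n\in\mathbb{N}}$ converges in the norm topology of $X$, uniformly on closed subsets of $B$, if and only if $$\sigma(h'(0))\subset\Omega(\alpha,\omega):=\{\omega\}\cup\left\{\zeta\in\mathbb{C}:\left|\zeta-\frac1\alpha\right|>\left|\omega-\frac1\alpha\right|\right\}.$$ Moreover, the limit of $\{\Phi_\alpha^n\}_{n\in\mathbb{N}}$ is a holomorphic retraction $$\phi_\alpha:B\to\mathrm{Null}(\omega I-h):=\{x\in B:h(x)=\omega x\}.$$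
   Context: $B=\{x\in X:\|x\|<1\}$; for $W\subseteq X$, $\mathrm{Hol}(B,W)$ is the set of holomorphic maps (i.e. maps admitting a complex Fréchet derivative at each point) from $B$ to $W$, and $\mathrm{Hol}(B)=\mathrm{Hol}(B,B)$. $h'(0)$ is the Fréchet derivative of $h$ at $0$, a bounded linear operator on $X$; $\sigma(h'(0))$ is its spectrum; $I$ is the identity operator; $\mathrm{Ker}$ and $\mathrm{Im}$ denote kernel and range of a linear operator. Abel average: for real $\alpha$ with $\alpha\omega\ne1$, $\Phi_\alpha=(I-\alpha h)^{-1}\circ[(1-\alpha\omega)I]$, i.e. $y=\Phi_\alpha(x)$ is the solution $y\in B$ of $y-\alpha h(y)=(1-\alpha\omega)x$. $\Phi_\alpha^n$ denotes the $n$-th iterate: $\Phi_\alpha^n=\Phi_\alpha^{n-1}\circ\Phi_\alpha$, $\Phi_\alpha^0=I$. A holomorphic retraction from $B$ on $R\subset B$ is a holomorphic self-map $\phi$ of $B$ such that $\phi(B)=R$ and $\phi(z)=z$ for all $z\in R$. The "moreover" part concerns the case in which the sequence converges.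
   Formalization: "Uniformly on closed subsets of B" is taken as uniformly on closed subsets lying in some smaller ball of radius r<1; for arbitrary closed subsets of B the claim fails, e.g. on c_0 with α=1, ω=0, h(x)_k = x_k − 4x_k/(3+x_k). *)

theory Defs
  imports "HOL-Analysis.Analysis"
begin

text \<open>HOL-Analysis has real Banach spaces only; a complex Banach space is a real one with a
  complex scalar multiplication that extends the real one and is compatible with the norm.\<close>

class complex_banach = banach +
  fixes scaleC :: "complex \<Rightarrow> 'a \<Rightarrow> 'a"  (infixr \<open>*\<^sub>C\<close> 75)
  assumes scaleC_add_right: "a *\<^sub>C (x + y) = a *\<^sub>C x + a *\<^sub>C y"
    and scaleC_add_left: "(a + b) *\<^sub>C x = a *\<^sub>C x + b *\<^sub>C x"
    and scaleC_scaleC: "a *\<^sub>C b *\<^sub>C x = (a * b) *\<^sub>C x"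
    and scaleR_scaleC: "r *\<^sub>R x = complex_of_real r *\<^sub>C x"
    and norm_scaleC: "norm (a *\<^sub>C x) = cmod a * norm x"

instantiation complex :: complex_banach
begin

definition scaleC_complex :: "complex \<Rightarrow> complex \<Rightarrow> complex"
  where "scaleC_complex a x = a * x"

instance
  by standard (simp_all add: scaleC_complex_def algebra_simps norm_mult scaleR_conv_of_real)

end

definition bounded_clinear :: "('a::complex_banach \<Rightarrow> 'b::complex_banach) \<Rightarrow> bool"
  where "bounded_clinear T \<longleftrightarrow> bounded_linear T \<and> (\<forall>c x. T (c *\<^sub>C x) = c *\<^sub>C T x)"

definition spectrum :: "('a::complex_banach \<Rightarrow> 'a) \<Rightarrow> complex set"
  where "spectrum T =
    {\<zeta>. \<not> (\<exists>S. bounded_clinear S \<and>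
             (\<forall>x. S (\<zeta> *\<^sub>C x - T x) = x) \<and> (\<forall>x. \<zeta> *\<^sub>C S x - T (S x) = x))}"

definition kernel :: "('a \<Rightarrow> 'b::zero) \<Rightarrow> 'a set"
  where "kernel T = {x. T x = 0}"

definition is_direct_sum :: "'a::ab_group_add set \<Rightarrow> 'a set \<Rightarrow> bool"
  where "is_direct_sum U V \<longleftrightarrow> U \<inter> V = {0} \<and> (\<forall>x. \<exists>u\<in>U. \<exists>v\<in>V. x = u + v)"

text \<open>Maps on an open set \<open>D\<close> are total functions whose values outside \<open>D\<close> are irrelevant.\<close>

definition Hol :: "'a::complex_banach set \<Rightarrow> 'b::complex_banach set \<Rightarrow> ('a \<Rightarrow> 'b) set"
  where "Hol D W =
    {f. f ` D \<subseteq> W \<and> (\<forall>x\<in>D. \<exists>f'. (f has_derivative f') (at x) \<and> bounded_clinear f')}"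

abbreviation unit_ball :: "'a::complex_banach set"
  where "unit_ball \<equiv> ball 0 1"

text \<open>The description operator in \<open>abel_average\<close> is meaningful only when the defining equation
  has exactly one solution in the ball, so this is part of asserting that \<open>\<Phi>\<^sub>\<alpha>\<close> is a self-map.\<close>

definition abel_average_defined :: "('a::complex_banach \<Rightarrow> 'a) \<Rightarrow> real \<Rightarrow> real \<Rightarrow> bool"
  where "abel_average_defined h \<alpha> \<omega> \<longleftrightarrow>
    (\<forall>x\<in>unit_ball. \<exists>!y. y \<in> unit_ball \<and> y - \<alpha> *\<^sub>R h y = (1 - \<alpha> * \<omega>) *\<^sub>R x)"

definition abel_average :: "('a::complex_banach \<Rightarrow> 'a) \<Rightarrow> real \<Rightarrow> real \<Rightarrow> 'a \<Rightarrow> 'a"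
  where "abel_average h \<alpha> \<omega> x =
    (THE y. y \<in> unit_ball \<and> y - \<alpha> *\<^sub>R h y = (1 - \<alpha> * \<omega>) *\<^sub>R x)"

definition Omega :: "real \<Rightarrow> real \<Rightarrow> complex set"
  where "Omega \<alpha> \<omega> = {complex_of_real \<omega>} \<union>
    {\<zeta>. cmod (\<zeta> - 1 / complex_of_real \<alpha>) > cmod (complex_of_real \<omega> - 1 / complex_of_real \<alpha>)}"

text \<open>Norm convergence, uniform on the closed subsets lying strictly inside the unit ball
  (at positive distance from the unit sphere). This proviso is essential: a norm-closed subset of
  the open ball of an infinite-dimensional space may approach the sphere. With \<open>\<alpha> = 1\<close>, \<open>\<omega> = 0\<close>
  and \<open>h(x)\<^sub>k = x\<^sub>k - 4x\<^sub>k / (3 + x\<^sub>k)\<close> on \<open>c\<^sub>0\<close>, the Abel average is \<open>x\<^sub>k \<mapsto> 3x\<^sub>k / (4 - x\<^sub>k)\<close>; its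
  iterates tend to 0 uniformly on smaller balls, but not on the closed set of the points
  \<open>(1 - 1/k) e\<^sub>k\<close>.\<close>

definition converges_inside_ball ::
    "(nat \<Rightarrow> 'a::complex_banach \<Rightarrow> 'a) \<Rightarrow> ('a \<Rightarrow> 'a) \<Rightarrow> bool"
  where "converges_inside_ball F \<phi> \<longleftrightarrow>
    (\<forall>K. closed K \<and> (\<exists>r<1. K \<subseteq> cball 0 r) \<longrightarrow> uniform_limit K F \<phi> sequentially)"

definition holomorphic_retraction :: "('a::complex_banach \<Rightarrow> 'a) \<Rightarrow> 'a set \<Rightarrow> bool"
  where "holomorphic_retraction \<phi> R \<longleftrightarrow>
    R \<subseteq> unit_ball \<and> \<phi> \<in> Hol unit_ball unit_ball \<and> \<phi> ` unit_ball = R \<and> (\<forall>z\<in>R. \<phi> z = z)"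

definition Null :: "('a::complex_banach \<Rightarrow> 'a) \<Rightarrow> real \<Rightarrow> 'a set"
  where "Null h \<omega> = {x \<in> unit_ball. h x = \<omega> *\<^sub>R x}"

end

theory Submission
  imports Defs "HOL-Complex_Analysis.Conformal_Mappings"
begin

text \<open>Write \<open>F\<close> for the Abel average and \<open>A = F'(0)\<close>. The map \<open>y \<mapsto> (y - \<alpha> h(y)) / (1 - \<alpha>\<omega>)\<close> inverts
  \<open>F\<close> near 0, so \<open>A\<close> is invertible with inverse \<open>(I - \<alpha> h'(0)) / (1 - \<alpha>\<omega>)\<close>. Thus \<open>I - A\<close> has the same
  kernel and range as \<open>\<omega>I - h'(0)\<close>, and the spectral condition says that \<open>\<sigma>(A)\<close> lies in the open unit
  disc together with the point 1. Cauchy estimates for the self-maps \<open>F\<^sup>n\<close> give \<open>\<bar>A\<^sup>n\<bar> \<le> 1\<close>.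

  Convergence of \<open>F\<^sup>n\<close> forces convergence of \<open>A\<^sup>n\<close> in norm, again by a Cauchy estimate, and this excludes
  every spectral point \<open>\<mu> \<noteq> 1\<close> with \<open>\<bar>\<mu>\<bar> \<ge> 1\<close>. Conversely, under the spectral condition \<open>I - \<mu>A\<close> is bounded
  below on the range of \<open>I - A\<close>, uniformly for \<open>\<mu>\<close> in the unit circle (Baire's theorem is needed for
  \<open>\<mu> = 1\<close>), and a discrete Fourier argument makes \<open>A\<^sup>n\<close> tend to 0 in norm there. Near 0 the maps
  \<open>F\<^sup>n\<close> differ from \<open>A\<^sup>n\<close> by maps with a small Lipschitz constant that does not depend on \<open>n\<close>; together
  with boundedness of the orbits this makes them converge uniformly near 0, hence, by power series
  expansion along complex lines, on all smaller balls.\<close>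

section \<open>Complex Banach spaces and the Hahn--Banach theorem\<close>

lemma scaleC_one [simp]: "1 *\<^sub>C x = (x::'a::complex_banach)"
  by (metis of_real_1 scaleR_one scaleR_scaleC)

text \<open>Seen as a bounded bilinear operation, complex scaling inherits the library rules for
  limits, derivatives and sums.\<close>

lemma bounded_bilinear_scaleC: "bounded_bilinear (\<lambda>c (x::'a::complex_banach). c *\<^sub>C x)"
proof
  fix r :: real and c :: complex and x :: 'a
  show "(r *\<^sub>R c) *\<^sub>C x = r *\<^sub>R (c *\<^sub>C x)"
    by (simp add: scaleR_scaleC[where 'a='a] scaleC_scaleC scaleR_conv_of_real)
  show "c *\<^sub>C (r *\<^sub>R x) = r *\<^sub>R (c *\<^sub>C x)"
    by (simp add: scaleR_scaleC[where 'a='a] scaleC_scaleC mult.commute)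
  show "\<exists>K. \<forall>c (x::'a). norm (c *\<^sub>C x) \<le> norm c * norm x * K"
    by (rule exI[of _ 1]) (simp add: norm_scaleC)
qed (simp_all add: scaleC_add_left scaleC_add_right)

interpretation scaleC: bounded_bilinear "\<lambda>c (x::'a::complex_banach). c *\<^sub>C x"
  by (rule bounded_bilinear_scaleC)

lemmas [simp] = scaleC.zero_left scaleC.zero_right

lemma scaleC_of_real: "complex_of_real r *\<^sub>C x = r *\<^sub>R x"
  by (simp only: scaleR_scaleC)

lemmas scaleC_algebra = scaleC.diff_left scaleC.diff_right scaleC_add_left scaleC_add_right
  scaleC_scaleC

lemma bounded_clinear_linear: "bounded_clinear T \<Longrightarrow> linear T"
  by (simp add: bounded_clinear_def bounded_linear.linear)

lemma bounded_clinear_scaleC: "bounded_clinear T \<Longrightarrow> T (c *\<^sub>C x) = c *\<^sub>C T x"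
  by (simp add: bounded_clinear_def)

lemma bounded_clinear_id: "bounded_clinear (\<lambda>x. x)"
  by (simp add: bounded_clinear_def bounded_linear_ident)

lemma bounded_clinear_scale: "bounded_clinear T \<Longrightarrow> bounded_clinear (\<lambda>x. c *\<^sub>C T x)"
  by (auto simp: bounded_clinear_def scaleC_scaleC mult.commute
      intro: bounded_linear_compose[OF scaleC.bounded_linear_right])

lemma bounded_clinear_diff:
  "bounded_clinear S \<Longrightarrow> bounded_clinear T \<Longrightarrow> bounded_clinear (\<lambda>x. S x - T x)"
  by (auto simp: bounded_clinear_def scaleC.diff_right bounded_linear_sub)

lemma bounded_clinear_compose:
  "bounded_clinear S \<Longrightarrow> bounded_clinear T \<Longrightarrow> bounded_clinear (\<lambda>x. S (T x))"
  by (auto simp: bounded_clinear_def bounded_linear_compose)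

lemma bounded_clinear_funpow:
  fixes T :: "'a::complex_banach \<Rightarrow> 'a"
  shows "bounded_clinear T \<Longrightarrow> bounded_clinear (T ^^ n)"
proof (induction n)
  case (Suc n)
  then show ?case
    using bounded_clinear_compose[of T "T ^^ n"] by (simp add: o_def)
qed (simp add: bounded_clinear_id id_def)

lemma real_norming_functional:
  fixes x0 :: "'a::real_normed_vector"
  obtains l where "linear l" "\<And>x. l x \<le> norm x" "l x0 = norm x0"
proof -
  txt \<open>Zorn's lemma is applied to graphs of partial functionals, as subspaces of \<open>'a \<times> real\<close>;
    the bound \<open>t \<le> norm x\<close> alone makes such a subspace single-valued.\<close>
  define \<A> where "\<A> = {M. subspace M \<and> (x0, norm x0) \<in> M \<and> (\<forall>(x, t)\<in>M. t \<le> norm x)}"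
  define M0 where "M0 = range (\<lambda>c. (c *\<^sub>R x0, c * norm x0))"
  have "subspace M0"
    unfolding subspace_def M0_def
  proof (intro conjI ballI allI)
    show "0 \<in> range (\<lambda>c. (c *\<^sub>R x0, c * norm x0))"
      by (rule range_eqI[of _ _ 0]) (simp add: zero_prod_def)
  next
    fix p q assume "p \<in> range (\<lambda>c. (c *\<^sub>R x0, c * norm x0))" "q \<in> range (\<lambda>c. (c *\<^sub>R x0, c * norm x0))"
    then obtain a b where "p = (a *\<^sub>R x0, a * norm x0)" "q = (b *\<^sub>R x0, b * norm x0)" by auto
    then have "p + q = ((a + b) *\<^sub>R x0, (a + b) * norm x0)"
      by (simp add: scaleR_add_left distrib_right)
    then show "p + q \<in> range (\<lambda>c. (c *\<^sub>R x0, c * norm x0))"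
      by (rule range_eqI)
  next
    fix c p assume "p \<in> range (\<lambda>c. (c *\<^sub>R x0, c * norm x0))"
    then obtain a where "p = (a *\<^sub>R x0, a * norm x0)" by auto
    then have "c *\<^sub>R p = ((c * a) *\<^sub>R x0, (c * a) * norm x0)"
      by simp
    then show "c *\<^sub>R p \<in> range (\<lambda>c. (c *\<^sub>R x0, c * norm x0))"
      by (rule range_eqI)
  qed
  moreover have "(x0, norm x0) \<in> M0"
    unfolding M0_def by (rule range_eqI[of _ _ 1]) simp
  moreover have "c * norm x0 \<le> norm (c *\<^sub>R x0)" for c
    by (simp add: mult_right_mono)
  ultimately have "M0 \<in> \<A>"
    by (auto simp: \<A>_def M0_def)
  have chain: "\<Union>\<C> \<in> \<A>" if "\<C> \<noteq> {}" "subset.chain \<A> \<C>" for \<C>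
  proof -
    have sub: "\<C> \<subseteq> \<A>" and tot: "\<And>U V. U \<in> \<C> \<Longrightarrow> V \<in> \<C> \<Longrightarrow> U \<subseteq> V \<or> V \<subseteq> U"
      using that(2) by (auto simp: subset_chain_def)
    have "subspace (\<Union>\<C>)"
      unfolding subspace_def
    proof (intro conjI ballI allI)
      show "0 \<in> \<Union>\<C>"
        using that(1) sub by (auto simp: \<A>_def subspace_def)
    next
      fix p q assume "p \<in> \<Union>\<C>" "q \<in> \<Union>\<C>"
      then obtain U V where UV: "U \<in> \<C>" "V \<in> \<C>" "p \<in> U" "q \<in> V" by auto
      then obtain W where "W \<in> \<C>" "p \<in> W" "q \<in> W"
        using tot[of U V] by auto
      moreover have "subspace W" using \<open>W \<in> \<C>\<close> sub by (auto simp: \<A>_def)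
      ultimately show "p + q \<in> \<Union>\<C>"
        by (meson UnionI subspace_add)
    next
      fix c p assume "p \<in> \<Union>\<C>"
      then obtain U where U: "U \<in> \<C>" "p \<in> U" by auto
      then have "subspace U" using sub by (auto simp: \<A>_def)
      then show "c *\<^sub>R p \<in> \<Union>\<C>"
        using U by (meson UnionI subspace_scale)
    qed
    then show ?thesis
      using that(1) sub by (auto simp: \<A>_def)
  qed
  obtain M where M: "M \<in> \<A>" and max: "\<And>N. N \<in> \<A> \<Longrightarrow> M \<subseteq> N \<Longrightarrow> N = M"
    using subset_Zorn_nonempty[of \<A>] chain \<open>M0 \<in> \<A>\<close> by (metis empty_iff)
  have subM: "subspace M" and x0M: "(x0, norm x0) \<in> M"
    and leM: "\<And>x t. (x, t) \<in> M \<Longrightarrow> t \<le> norm x"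
    using M by (auto simp: \<A>_def)
  have total: "\<exists>t. (x, t) \<in> M" for x
  proof -
    \<comment> \<open>A value \<open>a\<close> at \<open>x\<close> is admissible if it lies between
      every \<open>t - norm (y - x)\<close> and every \<open>norm (z + x) - s\<close>. The triangle
      inequality separates the two families, and \<open>a\<close> is the supremum of the lower
      one.\<close>
    define D where "D = (\<lambda>(y, t). t - norm (y - x)) ` M"
    have bound: "t - norm (y - x) \<le> norm (z + x) - s" if "(y, t) \<in> M" "(z, s) \<in> M" for y z s t
    proof -
      have "t + s \<le> norm (y + z)"
        using subspace_add[OF subM that] leM by simp
      also have "\<dots> \<le> norm (y - x) + norm (z + x)"
        using norm_triangle_ineq[of "y - x" "z + x"] by (simp add: algebra_simps)
      finally show ?thesis by simp
    qed
    define a where "a = Sup D"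
    have bdd: "bdd_above D"
      unfolding bdd_above_def D_def using bound[OF _ x0M] by fast
    have up: "t - norm (y - x) \<le> a" if "(y, t) \<in> M" for y t
      unfolding a_def using that by (intro cSup_upper bdd) (force simp: D_def)
    have lo: "a \<le> norm (z + x) - s" if "(z, s) \<in> M" for z s
      unfolding a_def using x0M bound[OF _ that] by (intro cSup_least) (auto simp: D_def)
    define N where "N = {p + s *\<^sub>R (x, a) |p s. p \<in> M}"
    have NI: "p + s *\<^sub>R (x, a) \<in> N" if "p \<in> M" for p s
      unfolding N_def using that by blast
    have "subspace N"
      unfolding subspace_def
    proof (intro conjI ballI allI)
      show "0 \<in> N" using NI[of 0 0] subspace_0[OF subM] by (simp add: zero_prod_def)
    next
      fix p q assume "p \<in> N" "q \<in> N"
      then obtain p' s q' t where "p' \<in> M" "q' \<in> M"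
        and eq: "p = p' + s *\<^sub>R (x, a)" "q = q' + t *\<^sub>R (x, a)"
        unfolding N_def by blast
      then have "p' + q' \<in> M" using subM by (simp add: subspace_add)
      then have "(p' + q') + (s + t) *\<^sub>R (x, a) \<in> N" by (rule NI)
      then show "p + q \<in> N" by (simp add: eq algebra_simps scaleR_add_left del: scaleR_Pair)
    next
      fix c p assume "p \<in> N"
      then obtain p' s where "p' \<in> M" and eq: "p = p' + s *\<^sub>R (x, a)"
        unfolding N_def by blast
      then have "c *\<^sub>R p' \<in> M" using subM by (simp add: subspace_scale)
      then have "c *\<^sub>R p' + (c * s) *\<^sub>R (x, a) \<in> N" by (rule NI)
      then show "c *\<^sub>R p \<in> N" by (simp add: eq scaleR_add_right del: scaleR_Pair)
    qed
    moreover have "M \<subseteq> N"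
      using NI[of _ 0] by auto
    moreover have "t + s * a \<le> norm (y + s *\<^sub>R x)" if yt: "(y, t) \<in> M" for y t s
    proof -
      \<comment> \<open>After division by the absolute value of \<open>s\<close>, positive
        \<open>s\<close> is governed by \<open>lo\<close> and negative \<open>s\<close> by
        \<open>up\<close>.\<close>
      consider "s = 0" | "s > 0" | "s < 0" by linarith
      then show ?thesis
      proof cases
        case 1 then show ?thesis using leM[OF yt] by simp
      next
        case 2
        have "(inverse s *\<^sub>R y, inverse s * t) \<in> M"
          using subspace_scale[OF subM yt, of "inverse s"] by simp
        from lo[OF this] have "s * a \<le> s * (norm (inverse s *\<^sub>R y + x) - inverse s * t)"
          using 2 by (intro mult_left_mono) auto
        also have "\<dots> = norm (s *\<^sub>R (inverse s *\<^sub>R y + x)) - t"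
          using 2 by (simp add: right_diff_distrib)
        also have "\<dots> = norm (y + s *\<^sub>R x) - t"
          using 2 by (simp add: scaleR_add_right)
        finally show ?thesis by simp
      next
        case 3
        define r where "r = - s"
        have r: "r > 0" using 3 by (simp add: r_def)
        have "(inverse r *\<^sub>R y, inverse r * t) \<in> M"
          using subspace_scale[OF subM yt, of "inverse r"] by simp
        from up[OF this] have "r * (inverse r * t - norm (inverse r *\<^sub>R y - x)) \<le> r * a"
          using r by (intro mult_left_mono) auto
        moreover have "r *\<^sub>R (inverse r *\<^sub>R y - x) = y + s *\<^sub>R x"
          using r by (simp add: r_def scaleR_diff_right)
        then have "r * norm (inverse r *\<^sub>R y - x) = norm (y + s *\<^sub>R x)"
          using r by (metis abs_of_pos norm_scaleR)
        then have "r * (inverse r * t - norm (inverse r *\<^sub>R y - x)) = t - norm (y + s *\<^sub>R x)"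
          using r by (simp add: right_diff_distrib)
        ultimately have "t - norm (y + s *\<^sub>R x) \<le> r * a" by linarith
        then show ?thesis by (simp add: r_def)
      qed
    qed
    then have "\<forall>(z, t)\<in>N. t \<le> norm z"
      by (auto simp: N_def)
    ultimately have "N \<in> \<A>"
      using x0M unfolding \<A>_def by blast
    then have "N = M" using max \<open>M \<subseteq> N\<close> by blast
    moreover have "(x, a) \<in> N"
      using NI[of 0 1] subspace_0[OF subM] by simp
    ultimately show ?thesis by auto
  qed
  have unique: "t = s" if "(x, t) \<in> M" "(x, s) \<in> M" for x t s
    using leM[of 0 "t - s"] leM[of 0 "s - t"] subspace_diff[OF subM that]
      subspace_diff[OF subM that(2,1)] by simp
  define l where "l = (\<lambda>x. SOME t. (x, t) \<in> M)"
  have lM: "(x, l x) \<in> M" for x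
    unfolding l_def using total by (rule someI_ex)
  have "linear l"
  proof (rule linearI)
    show "l (x + y) = l x + l y" for x y
      using subspace_add[OF subM lM[of x] lM[of y]] lM[of "x + y"] unique by simp
    show "l (c *\<^sub>R x) = c *\<^sub>R l x" for c x
      using subspace_scale[OF subM lM[of x], of c] lM[of "c *\<^sub>R x"] unique by simp
  qed
  then show ?thesis
    using that[of l] leM lM x0M unique by blast
qed

text \<open>A complex-linear functional is recovered from its real part \<open>l\<close> by taking
  \<open>- l (\<i> *\<^sub>C x)\<close> as imaginary part. Rotating \<open>x\<close> by a unimodular
  \<open>u\<close> makes the value real and nonnegative, so the bound on \<open>l\<close> becomes a
  bound on the modulus.\<close>

lemma norming_functional:
  fixes x0 :: "'a::complex_banach"
  obtains L :: "'a \<Rightarrow> complex"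
  where "bounded_clinear L" "\<And>x. cmod (L x) \<le> norm x" "L x0 = of_real (norm x0)"
proof -
  obtain l where l: "linear l" "\<And>x. l x \<le> norm x" "l x0 = norm x0"
    using real_norming_functional[of x0] by blast
  define L where "L x = Complex (l x) (- l (\<i> *\<^sub>C x))" for x
  have ii: "\<i> *\<^sub>C \<i> *\<^sub>C x = - x" for x :: 'a
  proof -
    have "\<i> *\<^sub>C \<i> *\<^sub>C x = (-1) *\<^sub>C x" by (simp add: scaleC_scaleC)
    then show ?thesis by (simp add: scaleC.minus_left)
  qed
  have add: "L (x + y) = L x + L y" for x y
    by (simp add: L_def complex_eq_iff linear_add[OF l(1)] scaleC_add_right)
  have re: "L (r *\<^sub>R x) = r *\<^sub>R L x" for r x
    by (simp add: L_def complex_eq_iff linear_cmul[OF l(1)] scaleC.scaleR_right)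
  have im: "L (\<i> *\<^sub>C x) = \<i> * L x" for x
    by (simp add: L_def complex_eq_iff ii linear_neg[OF l(1)])
  have scale: "L (c *\<^sub>C x) = c * L x" for c x
  proof -
    have "c *\<^sub>C x = (of_real (Re c) + \<i> * of_real (Im c)) *\<^sub>C x"
      by (subst complex_eq) (rule refl)
    also have "\<dots> = Re c *\<^sub>R x + \<i> *\<^sub>C (Im c *\<^sub>R x)"
      by (simp only: scaleC_add_left scaleR_scaleC scaleC_scaleC)
    finally have "L (c *\<^sub>C x) = Re c *\<^sub>R L x + \<i> * (Im c *\<^sub>R L x)"
      by (simp add: add re im)
    also have "\<dots> = c * L x"
      by (simp add: complex_eq_iff)
    finally show ?thesis .
  qed
  have bound: "cmod (L x) \<le> norm x" for x
  proof (cases "L x = 0")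
    case False
    define u where "u = cnj (L x) / of_real (cmod (L x))"
    have u: "cmod u = 1" using False by (simp add: u_def norm_divide)
    have "L (u *\<^sub>C x) = of_real (cmod (L x))"
      using False complex_norm_square[of "L x"]
      by (simp add: scale u_def field_simps power2_eq_square)
    then have "l (u *\<^sub>C x) = cmod (L x)"
      by (simp add: L_def complex_eq_iff)
    moreover have "l (u *\<^sub>C x) \<le> norm x"
      using l(2)[of "u *\<^sub>C x"] u by (simp add: norm_scaleC)
    ultimately show ?thesis by simp
  qed simp
  have "bounded_linear L"
    by (rule bounded_linear_intro[where K = 1]) (auto simp: add re bound)
  then have "bounded_clinear L"
    by (simp add: bounded_clinear_def scale scaleC_complex_def)
  moreover have "L x0 = of_real (norm x0)"
  proof -
    \<comment> \<open>The real part of \<open>L x0\<close> is already \<open>norm x0\<close>, the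
      largest modulus allowed, so no room is left for an imaginary part.\<close>
    have "(cmod (L x0))\<^sup>2 \<le> (norm x0)\<^sup>2"
      using bound[of x0] by (simp add: power_mono)
    then have "(norm x0)\<^sup>2 + (Im (L x0))\<^sup>2 \<le> (norm x0)\<^sup>2"
      using l(3) by (simp add: cmod_power2 L_def)
    then show ?thesis using l(3)
      by (simp add: complex_eq_iff L_def)
  qed
  ultimately show ?thesis using that bound by blast
qed


section \<open>Bounded inverses and spectra\<close>

text \<open>The open mapping argument: Baire's theorem puts a ball into the closure of the image of
  some ball, successive approximation then solves \<open>L z = L x\<close> with a bound on
  \<open>z\<close>, and injectivity gives \<open>z = x\<close>.\<close>

theorem bounded_linear_bij_bounded_below:
  fixes L :: "'a::banach \<Rightarrow> 'b::banach"
  assumes L: "bounded_linear L" and "bij L"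
  obtains m where "m > 0" "\<And>x. m * norm x \<le> norm (L x)"
proof -
  interpret L: bounded_linear L by (rule L)
  define E where "E n = closure (L ` cball 0 (real n))" for n
  have "\<Union>(range E) = UNIV"
  proof -
    have "y \<in> \<Union>(range E)" for y
    proof -
      obtain x where "L x = y" using \<open>bij L\<close> by (metis bij_pointE)
      moreover obtain n where "norm x \<le> real n" using real_arch_simple by blast
      ultimately have "y \<in> L ` cball 0 (real n)" by auto
      then have "y \<in> E n" unfolding E_def by (rule subsetD[OF closure_subset])
      then show ?thesis by blast
    qed
    then show ?thesis by auto
  qed
  have "\<exists>n. interior (E n) \<noteq> {}"
  proof (rule ccontr)
    assume "\<not> ?thesis"
    then have "euclidean interior_of \<Union>(range E) = {}"
      by (intro Baire_category_alt disjI1 completely_metrizable_space_euclidean)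
        (auto simp: E_def closed_closedin[symmetric])
    then show False using \<open>\<Union>(range E) = UNIV\<close> by simp
  qed
  then obtain n where "interior (E n) \<noteq> {}" ..
  then obtain y0 e where e: "e > 0" "ball y0 e \<subseteq> E n"
    by (metis all_not_in_conv mem_interior)
  \<comment> \<open>Subtracting approximate preimages of \<open>y0 + y\<close> and \<open>y0\<close>
    recentres the ball at 0 and doubles the bound on the preimages.\<close>
  have small: "\<exists>x. norm x \<le> 2 * real n \<and> norm (y - L x) < d" if "norm y < e" "d > 0" for y d
  proof -
    have "y0 + y \<in> E n" "y0 \<in> E n" using e that by (auto simp: subset_iff dist_norm)
    moreover have "d / 2 > 0" using \<open>d > 0\<close> by simp
    ultimately obtain p q where "p \<in> L ` cball 0 (real n)" "dist p (y0 + y) < d/2"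
      "q \<in> L ` cball 0 (real n)" "dist q y0 < d/2"
      unfolding E_def closure_approachable by blast
    then obtain u v where uv: "norm u \<le> real n" "norm v \<le> real n"
      "norm (L u - (y0 + y)) < d/2" "norm (L v - y0) < d/2"
      by (auto simp: dist_norm)
    have "norm (u - v) \<le> 2 * real n" using norm_triangle_ineq4[of u v] uv by simp
    moreover have "norm (y - L (u - v)) < d"
    proof -
      have "y - L (u - v) = (L v - y0) - (L u - (y0 + y))" by (simp add: L.diff)
      then have "norm (y - L (u - v)) \<le> norm (L v - y0) + norm (L u - (y0 + y))"
        by (metis norm_triangle_ineq4)
      then show ?thesis using uv by simp
    qed
    ultimately show ?thesis by blast
  qed
  \<comment> \<open>Rescaling \<open>y\<close> to norm \<open>e / 2\<close> costs the factor
    \<open>2 * norm y / e\<close>, which meets the bound \<open>2 * real n\<close> from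
    \<open>small\<close>; the added 1 keeps \<open>K\<close> positive when
    \<open>n = 0\<close>.\<close>
  define K where "K = 4 * real n / e + 1"
  have "K > 0" using e by (simp add: K_def add_nonneg_pos)
  have "\<exists>x. norm x \<le> K * norm y \<and> norm (y - L x) \<le> norm y / 2" for y
  proof (cases "y = 0")
    case False
    define s where "s = 2 * norm y / e"
    have s: "s > 0" using False e by (simp add: s_def)
    have "norm (inverse s *\<^sub>R y) = e / 2" using False e by (simp add: s_def)
    then have "norm (inverse s *\<^sub>R y) < e" "e / 4 > 0" using e by auto
    from small[OF this] obtain x where x: "norm x \<le> 2 * real n" "norm (inverse s *\<^sub>R y - L x) < e / 4"
      by blast
    have "norm (s *\<^sub>R x) \<le> s * (2 * real n)" using x s by (simp add: mult_left_mono)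
    also have "\<dots> \<le> K * norm y" using e by (simp add: s_def K_def field_simps)
    finally have "norm (s *\<^sub>R x) \<le> K * norm y" .
    moreover have "y - L (s *\<^sub>R x) = s *\<^sub>R (inverse s *\<^sub>R y - L x)"
      using s by (simp add: L.scaleR scaleR_diff_right)
    then have "norm (y - L (s *\<^sub>R x)) \<le> s * (e / 4)"
      using x s by simp
    then have "norm (y - L (s *\<^sub>R x)) \<le> norm y / 2" using e by (simp add: s_def)
    ultimately show ?thesis by blast
  qed (auto intro: exI[of _ 0])
  then obtain g where g: "\<And>y. norm (g y) \<le> K * norm y" "\<And>y. norm (y - L (g y)) \<le> norm y / 2"
    by metis
  have "norm x \<le> 2 * K * norm (L x)" for x
  proof -
    \<comment> \<open>\<open>r k\<close> is what remains of \<open>L x\<close> after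
      \<open>k\<close> approximation steps. It at least halves each time, so the corrections
      \<open>g (r k)\<close> sum absolutely and their images telescope to
      \<open>L x\<close>.\<close>
    define r where "r k = ((\<lambda>y. y - L (g y)) ^^ k) (L x)" for k
    have r_0: "r 0 = L x" by (simp add: r_def)
    have r_Suc: "r (Suc k) = r k - L (g (r k))" for k by (simp add: r_def)
    have r_le: "norm (r k) \<le> norm (L x) * (1/2) ^ k" for k
    proof (induction k)
      case (Suc k)
      then show ?case using g(2)[of "r k"] by (simp add: r_Suc)
    qed (simp add: r_def)
    have g_le: "norm (g (r k)) \<le> K * norm (L x) * (1/2) ^ k" for k
      using order_trans[OF g(1) mult_left_mono[OF r_le less_imp_le[OF \<open>K > 0\<close>]]] by (simp add: mult.assoc)
    have geo: "(\<lambda>k. K * norm (L x) * (1/2) ^ k) sums (K * norm (L x) * 2)"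
      using sums_mult[OF geometric_sums[of "1/2::real"], of "K * norm (L x)"] by simp
    have summ: "summable (\<lambda>k. norm (g (r k)))"
      by (rule summable_comparison_test'[OF sums_summable[OF geo], of 0]) (use g_le in auto)
    define z where "z = (\<Sum>k. g (r k))"
    have "(\<lambda>k. g (r k)) sums z"
      unfolding z_def by (rule summable_sums[OF summable_norm_cancel[OF summ]])
    then have "(\<lambda>k. L (g (r k))) sums L z" by (rule L.sums)
    moreover have "r \<longlonglongrightarrow> 0"
    proof (rule Lim_null_comparison)
      show "\<forall>\<^sub>F k in sequentially. norm (r k) \<le> norm (L x) * (1/2) ^ k" using r_le by simp
      show "(\<lambda>k. norm (L x) * (1/2) ^ k) \<longlonglongrightarrow> 0"
        by (intro tendsto_mult_right_zero LIMSEQ_realpow_zero) auto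
    qed
    then have "(\<lambda>k. r k - r (Suc k)) sums (r 0 - 0)" by (rule telescope_sums')
    then have "(\<lambda>k. L (g (r k))) sums (L x)" by (simp add: r_Suc r_0)
    ultimately have "L z = L x" by (rule sums_unique2)
    then have "z = x" using \<open>bij L\<close> by (simp add: bij_def inj_def)
    have "norm z \<le> (\<Sum>k. norm (g (r k)))" unfolding z_def by (rule summable_norm[OF summ])
    also have "\<dots> \<le> K * norm (L x) * 2"
      using suminf_le[OF g_le summ sums_summable[OF geo]] sums_unique[OF geo] by simp
    finally show ?thesis using \<open>z = x\<close> by simp
  qed
  then have "inverse (2 * K) * norm x \<le> norm (L x)" for x
    using \<open>K > 0\<close> by (simp add: field_simps)
  then show ?thesis using that[of "inverse (2 * K)"] \<open>K > 0\<close> by simp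
qed

text \<open>The spectrum is defined through bounded inverses; by completeness an algebraic inverse
  is automatically bounded.\<close>

lemma spectrum_iff_not_bij:
  assumes T: "bounded_clinear T"
  shows "\<zeta> \<in> spectrum T \<longleftrightarrow> \<not> bij (\<lambda>x. \<zeta> *\<^sub>C x - T x)"
proof -
  let ?L = "\<lambda>x. \<zeta> *\<^sub>C x - T x"
  have L: "bounded_clinear ?L"
    by (intro bounded_clinear_diff bounded_clinear_scale bounded_clinear_id T)
  have "\<exists>S. bounded_clinear S \<and> (\<forall>x. S (?L x) = x) \<and> (\<forall>x. \<zeta> *\<^sub>C S x - T (S x) = x)" if "bij ?L"
  proof -
    define S where "S = inv ?L"
    have SL: "S (?L x) = x" for x
      using that by (simp add: S_def bij_is_inj inv_f_f[of ?L])
    have LS: "?L (S x) = x" for x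
      using surj_f_inv_f[OF bij_is_surj[OF that]] by (simp add: S_def)
    obtain m where m: "m > 0" "\<And>x. m * norm x \<le> norm (?L x)"
      using bounded_linear_bij_bounded_below[OF _ \<open>bij ?L\<close>] L unfolding bounded_clinear_def by metis
    have add: "S (x + y) = S x + S y" for x y
      using SL[of "S x + S y"] LS linear_add[OF bounded_clinear_linear[OF L], of "S x" "S y"] by simp
    have scale: "S (c *\<^sub>C x) = c *\<^sub>C S x" for c x
      using SL[of "c *\<^sub>C S x"] LS bounded_clinear_scaleC[OF L, of c "S x"] by simp
    have "bounded_linear S"
    proof (rule bounded_linear_intro[where K = "inverse m"])
      show "S (r *\<^sub>R x) = r *\<^sub>R S x" for r x by (simp add: scaleR_scaleC scale)
      show "norm (S x) \<le> norm x * inverse m" for x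
        using m(2)[of "S x"] LS[of x] \<open>m > 0\<close> by (simp add: field_simps)
    qed (rule add)
    then show ?thesis
      using SL LS scale by (auto simp: bounded_clinear_def)
  qed
  moreover have "bij ?L" if "\<forall>x. S (?L x) = x" "\<forall>x. \<zeta> *\<^sub>C S x - T (S x) = x" for S
    by (rule o_bij[of S]) (use that in \<open>auto simp: fun_eq_iff\<close>)
  ultimately show ?thesis
    unfolding spectrum_def by blast
qed

text \<open>A preimage of \<open>y\<close> is a fixed point of the contraction that sends
  \<open>x\<close> to \<open>inverse \<kappa> *\<^sub>C (y + K x)\<close>.\<close>

lemma surj_scaleC_diff_contraction:
  assumes K: "bounded_clinear K" "\<And>x. norm (K x) \<le> q * norm x" and "q < cmod \<kappa>"
  shows "surj (\<lambda>x. \<kappa> *\<^sub>C x - K x)"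
proof (rule surjI)
  have "\<exists>x. \<kappa> *\<^sub>C x - K x = y" for y
  proof (cases "q \<ge> 0")
    case True
    then have \<kappa>: "\<kappa> \<noteq> 0" using assms(3) by auto
    have "dist (inverse \<kappa> *\<^sub>C (y + K x)) (inverse \<kappa> *\<^sub>C (y + K x')) \<le> q / cmod \<kappa> * dist x x'" for x x'
    proof -
      have "inverse \<kappa> *\<^sub>C (y + K x) - inverse \<kappa> *\<^sub>C (y + K x') = inverse \<kappa> *\<^sub>C K (x - x')"
        by (simp add: scaleC.diff_right[symmetric] linear_diff[OF bounded_clinear_linear[OF K(1)]])
      then have "dist (inverse \<kappa> *\<^sub>C (y + K x)) (inverse \<kappa> *\<^sub>C (y + K x'))
          = norm (K (x - x')) / cmod \<kappa>"
        by (simp add: dist_norm norm_scaleC norm_inverse divide_inverse)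
      then show ?thesis using K(2)[of "x - x'"] by (simp add: dist_norm divide_right_mono)
    qed
    then obtain x where "inverse \<kappa> *\<^sub>C (y + K x) = x"
      using banach_fix_type[of "q / cmod \<kappa>" "\<lambda>x. inverse \<kappa> *\<^sub>C (y + K x)"] True assms(3) \<kappa> by auto
    then have "\<kappa> *\<^sub>C inverse \<kappa> *\<^sub>C (y + K x) = \<kappa> *\<^sub>C x" by simp
    then have "y + K x = \<kappa> *\<^sub>C x" using \<kappa> by (simp add: scaleC_scaleC)
    then show ?thesis by (metis add_diff_cancel_right')
  next
    case False
    \<comment> \<open>A negative \<open>q\<close> is compatible with the bound on \<open>K\<close>
      only in the zero space.\<close>
    have "x = 0" for x :: 'a
    proof (rule ccontr)
      assume "x \<noteq> 0"
      then have "q * norm x < 0" using False by (simp add: mult_neg_pos)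
      then show False using K(2)[of x] norm_ge_zero[of "K x"] by linarith
    qed
    then show ?thesis by metis
  qed
  then show "(\<lambda>x. \<kappa> *\<^sub>C x - K x) (SOME x. \<kappa> *\<^sub>C x - K x = y) = y" for y
    by (metis (mono_tags, lifting) someI_ex)
qed

text \<open>The hypothesis makes \<open>E = A ^^ n\<close> almost idempotent, and
  \<open>(\<mu>\<^sup>n - E)((\<mu>\<^sup>n - 1) + E) = \<mu>\<^sup>n (\<mu>\<^sup>n - 1) + (E - E\<^sup>2)\<close>. Among two consecutive powers \<open>\<mu>\<^sup>n\<close> one is
  at distance at least \<open>\<bar>\<mu> - 1\<bar> / 2\<close> from 1.\<close>

lemma bij_diff_of_Cauchy_powers:
  assumes A: "bounded_clinear A"
    and Cau: "\<And>e. e > 0 \<Longrightarrow> \<exists>N. \<forall>m\<ge>N. \<forall>n\<ge>N. \<forall>x. norm ((A ^^ m) x - (A ^^ n) x) \<le> e * norm x"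
    and \<mu>: "cmod \<mu> \<ge> 1" "\<mu> \<noteq> 1"
  shows "bij (\<lambda>x. \<mu> *\<^sub>C x - A x)"
proof -
  define e where "e = cmod (\<mu> - 1) / 4"
  have e: "e > 0" using \<mu> by (simp add: e_def)
  obtain N where N: "\<And>m n x. m \<ge> N \<Longrightarrow> n \<ge> N \<Longrightarrow> norm ((A ^^ m) x - (A ^^ n) x) \<le> e * norm x"
    using Cau[OF e] by blast
  obtain n where n: "n \<ge> N" "cmod (\<mu> ^ n - 1) \<ge> 2 * e"
  proof -
    have "cmod (\<mu> - 1) \<le> cmod (\<mu> ^ N) * cmod (\<mu> - 1)"
      using \<mu> by (simp add: norm_power mult_le_cancel_right1 one_le_power)
    also have "\<dots> = cmod ((\<mu> ^ Suc N - 1) - (\<mu> ^ N - 1))"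
      by (simp flip: norm_mult add: algebra_simps)
    also have "\<dots> \<le> cmod (\<mu> ^ Suc N - 1) + cmod (\<mu> ^ N - 1)"
      by (rule norm_triangle_ineq4)
    finally have "2 * e \<le> cmod (\<mu> ^ Suc N - 1) \<or> 2 * e \<le> cmod (\<mu> ^ N - 1)"
      by (auto simp: e_def)
    then show ?thesis using that[of N] that[of "Suc N"] by auto
  qed
  define \<kappa> where "\<kappa> = \<mu> ^ n * (\<mu> ^ n - 1)"
  have "cmod (\<mu> ^ n - 1) \<le> cmod \<kappa>"
    using \<mu> by (simp add: \<kappa>_def norm_mult norm_power mult_le_cancel_right1 one_le_power)
  then have \<kappa>: "e < cmod \<kappa>" using n e by linarith
  define E where "E = A ^^ n"
  have E: "bounded_clinear E" unfolding E_def by (rule bounded_clinear_funpow[OF A])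
  have EE: "norm (E (E x) - E x) \<le> e * norm x" for x
    using N[of "n + n" n x] n(1) by (simp add: E_def funpow_add)
  have linA: "linear A" by (rule bounded_clinear_linear[OF A])
  show ?thesis
  proof (rule bijI)
    \<comment> \<open>An eigenvector of \<open>A\<close> for \<mu> satisfies
      \<open>E (E x) - E x = \<kappa> *\<^sub>C x\<close>, which is too large for
      \<open>EE\<close>.\<close>
    have "x = 0" if "A x = \<mu> *\<^sub>C x" for x
    proof (rule ccontr)
      assume "x \<noteq> 0"
      have pow: "(A ^^ k) x = \<mu> ^ k *\<^sub>C x" for k
      proof (induction k)
        case (Suc k)
        then show ?case
          using that by (simp add: bounded_clinear_scaleC[OF A] scaleC_scaleC mult.commute)
      qed simp
      have "E x = \<mu> ^ n *\<^sub>C x" by (simp add: E_def pow)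
      then have "E (E x) - E x = (\<mu> ^ n * \<mu> ^ n - \<mu> ^ n) *\<^sub>C x"
        by (simp add: bounded_clinear_scaleC[OF E] scaleC_scaleC scaleC.diff_left)
      also have "\<mu> ^ n * \<mu> ^ n - \<mu> ^ n = \<kappa>" by (simp add: \<kappa>_def right_diff_distrib)
      finally have "E (E x) - E x = \<kappa> *\<^sub>C x" .
      then have "cmod \<kappa> * norm x \<le> e * norm x" using EE[of x] by (simp add: norm_scaleC)
      then show False using \<open>x \<noteq> 0\<close> \<kappa> by (simp add: mult_le_cancel_right)
    qed
    moreover have "linear (\<lambda>x. \<mu> *\<^sub>C x - A x)"
      by (intro bounded_clinear_linear bounded_clinear_diff bounded_clinear_scale bounded_clinear_id A)
    ultimately show "inj (\<lambda>x. \<mu> *\<^sub>C x - A x)"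
      by (simp add: linear_injective_0)
    \<comment> \<open>The operator \<open>\<mu> ^ k - A ^^ k\<close> has \<open>\<mu> - A\<close> as
      a left factor, so its values lie in the range of \<open>\<mu> - A\<close>.\<close>
    have factor: "\<exists>b. \<mu> ^ k *\<^sub>C z - (A ^^ k) z = \<mu> *\<^sub>C b - A b" for z k
    proof (induction k)
      case 0
      show ?case by (rule exI[of _ 0]) (simp add: linear_0[OF linA])
    next
      case (Suc k)
      then obtain b where b: "\<mu> ^ k *\<^sub>C z - (A ^^ k) z = \<mu> *\<^sub>C b - A b" by blast
      have "A (\<mu> ^ k *\<^sub>C z) - (A ^^ Suc k) z = A (\<mu> *\<^sub>C b - A b)"
        by (simp flip: b add: linear_diff[OF linA])
      then have "\<mu> ^ Suc k *\<^sub>C z - (A ^^ Suc k) z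
          = \<mu> *\<^sub>C (\<mu> ^ k *\<^sub>C z + A b) - A (\<mu> ^ k *\<^sub>C z + A b)"
        by (simp add: linear_diff[OF linA] linear_add[OF linA] scaleC_algebra
            bounded_clinear_scaleC[OF A] algebra_simps)
      then show ?case by blast
    qed
    have surj: "surj (\<lambda>x. \<kappa> *\<^sub>C x - (E (E x) - E x))"
      by (rule surj_scaleC_diff_contraction[OF _ EE \<kappa>])
        (rule bounded_clinear_diff[OF bounded_clinear_compose[OF E E] E])
    have preimage: "\<exists>b. y = \<mu> *\<^sub>C b - A b" for y
    proof -
      obtain x where x: "y = \<kappa> *\<^sub>C x - (E (E x) - E x)"
        using surjD[OF surj, of y] by blast
      \<comment> \<open>\<open>w\<close> is the second factor of the factorization applied to
        \<open>x\<close>; the first factor then sends it to \<open>y\<close>.\<close>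
      define w where "w = (\<mu> ^ n - 1) *\<^sub>C x + E x"
      have "\<mu> ^ n *\<^sub>C w - E w = y"
        by (simp add: w_def x \<kappa>_def linear_add[OF bounded_clinear_linear[OF E]]
            linear_diff[OF bounded_clinear_linear[OF E]]
            bounded_clinear_scaleC[OF E] scaleC_algebra algebra_simps)
      then show ?thesis using factor[of n w] by (auto simp: E_def)
    qed
    show "surj (\<lambda>x. \<mu> *\<^sub>C x - A x)" unfolding surj_def using preimage by blast
  qed
qed


section \<open>Powers of an operator and its peripheral spectrum\<close>

text \<open>The ratio \<open>\<omega> ^ m\<close> is 1 exactly when \<open>N\<close> divides
  \<open>m\<close>; otherwise the geometric sum vanishes because the \<open>N\<close>-th power of
  the ratio is 1.\<close>

lemma sum_root_unity:
  assumes "N > 0" "\<omega> = exp (2 * of_real pi * \<i> / of_nat N)"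
  shows "(\<Sum>k<N. (\<omega> ^ m) ^ k) = (if N dvd m then of_nat N else 0)"
proof -
  have pow: "\<omega> ^ m = exp (2 * of_real pi * \<i> * of_nat m / of_nat N)" for m
    unfolding assms(2) by (simp flip: exp_of_nat_mult add: algebra_simps)
  have one: "\<omega> ^ m = 1 \<longleftrightarrow> N dvd m" for m
    unfolding pow using complex_root_unity_eq_1[of N m] assms(1) by simp
  have "(\<omega> ^ m) ^ N = 1"
    using one[of "m * N"] by (simp add: power_mult)
  then show ?thesis
    using one[of m] geometric_sum[of "\<omega> ^ m" N] by (cases "N dvd m") simp_all
qed

text \<open>Terms are paired with their successors, which leaves \<open>n\<close> small differences
  in place of \<open>2 * n\<close> norms.\<close>

lemma norm_alternating_sum_le:
  fixes f :: "nat \<Rightarrow> 'a::real_normed_vector"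
  assumes "\<And>k. norm (f k - f (Suc k)) \<le> c"
  shows "norm (\<Sum>k<2 * n. (- 1) ^ k *\<^sub>R f k) \<le> n * c"
proof (induction n)
  case (Suc n)
  have "(\<Sum>k<2 * Suc n. (- 1) ^ k *\<^sub>R f k)
      = (\<Sum>k<2 * n. (- 1) ^ k *\<^sub>R f k) + (f (2 * n) - f (Suc (2 * n)))"
    by simp
  then show ?case
    using Suc norm_triangle_ineq[of "\<Sum>k<2 * n. (- 1) ^ k *\<^sub>R f k" "f (2 * n) - f (Suc (2 * n))"]
      assms[of "2 * n"] by (simp add: algebra_simps)
qed simp

text \<open>Averaging \<open>f \<mu> = \<Sum>j<2n. \<mu>\<^sup>j A\<^sup>j y\<close> over the \<open>2n\<close>-th roots of unity \<open>\<omega>\<^sup>k\<close>, with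
  the signs \<open>(\<omega>\<^sup>k)\<^sup>n = (-1)\<^sup>k\<close>, isolates \<open>A\<^sup>n y\<close>, while values of \<open>f\<close> at neighbouring roots
  nearly cancel.\<close>

lemma norm_funpow_le_of_bounded_below:
  fixes A :: "'a::complex_banach \<Rightarrow> 'a"
  assumes A: "bounded_clinear A"
    and Y: "subspace Y" "\<And>c y. y \<in> Y \<Longrightarrow> c *\<^sub>C y \<in> Y" "\<And>y. y \<in> Y \<Longrightarrow> A y \<in> Y"
    and pb: "\<And>n x. norm ((A ^^ n) x) \<le> norm x"
    and m: "m > 0" "\<And>\<mu> y. cmod \<mu> = 1 \<Longrightarrow> y \<in> Y \<Longrightarrow> m * norm y \<le> norm (y - \<mu> *\<^sub>C A y)"
    and "y \<in> Y" "n > 0"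
  shows "norm ((A ^^ n) y) \<le> cmod (1 - exp (of_real pi * \<i> / of_nat n)) / m\<^sup>2 * norm y"
proof -
  define \<omega> where "\<omega> = exp (2 * of_real pi * \<i> / of_nat (2 * n))"
  have \<omega>_eq: "\<omega> = exp (of_real pi * \<i> / of_nat n)" by (simp add: \<omega>_def)
  have \<omega>_n: "\<omega> ^ n = -1"
    unfolding \<omega>_eq using \<open>n > 0\<close> by (simp flip: exp_of_nat_mult)
  then have \<omega>_2n: "\<omega> ^ (2 * n) = 1" by (simp add: mult.commute power_mult)
  have \<omega>_norm: "cmod \<omega> = 1" unfolding \<omega>_eq by (simp add: norm_exp_eq_Re)
  have linA: "linear A" by (rule bounded_clinear_linear[OF A])
  define f where "f \<mu> = (\<Sum>j<2 * n. \<mu> ^ j *\<^sub>C (A ^^ j) y)" for \<mu>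
  have "(A ^^ j) y \<in> Y" for j
    by (induction j) (use \<open>y \<in> Y\<close> Y(3) in auto)
  then have fY: "f \<mu> \<in> Y" for \<mu>
    unfolding f_def by (intro subspace_sum Y)
  \<comment> \<open>The sum telescopes under \<open>I - \<mu> A\<close>, and at a root of unity of
    order \<open>2 * n\<close> the last term loses its scalar factor. The lower bound on
    \<open>Y\<close> thereby controls \<open>f \<mu>\<close>.\<close>
  have f_eq: "f \<mu> - \<mu> *\<^sub>C A (f \<mu>) = y - (A ^^ (2 * n)) y" if "\<mu> ^ (2 * n) = 1" for \<mu>
  proof -
    have "\<mu> *\<^sub>C A (f \<mu>) = (\<Sum>j<2 * n. \<mu> ^ Suc j *\<^sub>C (A ^^ Suc j) y)"
      by (simp add: f_def linear_sum[OF linA] bounded_clinear_scaleC[OF A] scaleC.sum_right scaleC_scaleC)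
    then have "f \<mu> - \<mu> *\<^sub>C A (f \<mu>) = \<mu> ^ 0 *\<^sub>C (A ^^ 0) y - \<mu> ^ (2 * n) *\<^sub>C (A ^^ (2 * n)) y"
      unfolding f_def sum_subtractf[symmetric]
      using sum_lessThan_telescope'[of "\<lambda>j. \<mu> ^ j *\<^sub>C (A ^^ j) y" "2 * n"]
      by (simp only: sum_subtractf[symmetric])
    then show ?thesis using that by simp
  qed
  have f_norm: "norm (f \<mu>) \<le> 2 / m * norm y" if "cmod \<mu> = 1" "\<mu> ^ (2 * n) = 1" for \<mu>
  proof -
    have "m * norm (f \<mu>) \<le> norm (y - (A ^^ (2 * n)) y)"
      using m(2)[OF that(1) fY, of \<mu>] f_eq[OF that(2)] by simp
    also have "\<dots> \<le> 2 * norm y"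
      using norm_triangle_ineq4[of y "(A ^^ (2 * n)) y"] pb[of "2 * n" y] by linarith
    finally show ?thesis using m(1) by (simp add: field_simps)
  qed
  define g where "g k = f (\<omega> ^ k)" for k
  have root: "cmod (\<omega> ^ k) = 1" "(\<omega> ^ k) ^ (2 * n) = 1" for k
    using \<omega>_norm \<omega>_2n by (simp_all add: norm_power power_mult[symmetric] mult.commute[of k])
      (simp_all add: power_mult)
  \<comment> \<open>The right-hand side of \<open>f_eq\<close> is the same at all these roots, so
    subtracting it at neighbouring roots leaves a term with the factor \<open>1 - \<omega>\<close>.
    The lower bound enters a second time, whence the square of \<open>m\<close>.\<close>
  have g_diff: "norm (g k - g (Suc k)) \<le> 2 * cmod (1 - \<omega>) / m\<^sup>2 * norm y" for k
  proof -
    let ?d = "g k - g (Suc k)"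
    have "?d - \<omega> ^ k *\<^sub>C A ?d = (\<omega> ^ k - \<omega> ^ Suc k) *\<^sub>C A (g (Suc k))"
    proof -
      have "g k - \<omega> ^ k *\<^sub>C A (g k) = g (Suc k) - \<omega> ^ Suc k *\<^sub>C A (g (Suc k))"
        unfolding g_def by (simp only: f_eq[OF root(2)])
      then show ?thesis
        by (simp add: linear_diff[OF linA] scaleC.diff_left scaleC.diff_right algebra_simps)
    qed
    also have "\<omega> ^ k - \<omega> ^ Suc k = \<omega> ^ k * (1 - \<omega>)" by (simp add: algebra_simps)
    finally have "norm (?d - \<omega> ^ k *\<^sub>C A ?d) = cmod (1 - \<omega>) * norm (A (g (Suc k)))"
      using root(1) by (simp add: norm_scaleC norm_mult)
    moreover have "m * norm ?d \<le> norm (?d - \<omega> ^ k *\<^sub>C A ?d)"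
      using fY by (intro m(2) root subspace_diff Y) (auto simp: g_def)
    moreover have "cmod (1 - \<omega>) * norm (A (g (Suc k))) \<le> cmod (1 - \<omega>) * (2 / m * norm y)"
      using pb[of 1 "g (Suc k)"] f_norm[OF root, of "Suc k"]
      by (intro mult_left_mono) (simp_all add: g_def)
    ultimately have "m * norm ?d \<le> cmod (1 - \<omega>) * (2 / m * norm y)" by linarith
    then show ?thesis using m(1) by (simp add: field_simps power2_eq_square)
  qed
  have "(\<Sum>k<2 * n. (- 1) ^ k *\<^sub>R g k)
      = (\<Sum>k<2 * n. \<Sum>j<2 * n. (\<omega> ^ (n + j)) ^ k *\<^sub>C (A ^^ j) y)"
  proof (rule sum.cong[OF refl])
    fix k
    have "(- 1) ^ k *\<^sub>R g k = (\<omega> ^ n) ^ k *\<^sub>C g k"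
      by (simp add: \<omega>_n scaleR_scaleC)
    then show "(- 1) ^ k *\<^sub>R g k = (\<Sum>j<2 * n. (\<omega> ^ (n + j)) ^ k *\<^sub>C (A ^^ j) y)"
      by (simp add: g_def f_def scaleC.sum_right scaleC_scaleC power_add power_mult_distrib
          power_mult[symmetric] mult.commute)
  qed
  also have "\<dots> = (\<Sum>j<2 * n. (\<Sum>k<2 * n. (\<omega> ^ (n + j)) ^ k) *\<^sub>C (A ^^ j) y)"
    by (subst sum.swap) (simp add: scaleC.sum_left)
  also have "\<dots> = (\<Sum>j<2 * n. if j = n then of_nat (2 * n) *\<^sub>C (A ^^ n) y else 0)"
  proof (rule sum.cong[OF refl])
    fix j assume "j \<in> {..<2 * n}"
    \<comment> \<open>\<open>n + j\<close> lies strictly between 0 and \<open>4 * n\<close>, where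
      the only multiple of \<open>2 * n\<close> is \<open>2 * n\<close> itself.\<close>
    have "j = n" if "n + j = 2 * n * k" for k
    proof -
      have "n + j < 2 * n * 2" "n + j \<noteq> 0"
        using \<open>j \<in> {..<2 * n}\<close> \<open>n > 0\<close> by auto
      then have "2 * n * k < 2 * n * 2" "k \<noteq> 0"
        unfolding that by auto
      then have "k = 1" by simp
      then show ?thesis using that by simp
    qed
    then have "2 * n dvd n + j \<longleftrightarrow> j = n"
      by (auto simp: dvd_def intro: exI[of _ 1])
    then show "(\<Sum>k<2 * n. (\<omega> ^ (n + j)) ^ k) *\<^sub>C (A ^^ j) y
        = (if j = n then of_nat (2 * n) *\<^sub>C (A ^^ n) y else 0)"
      using sum_root_unity[OF _ \<omega>_def, of "n + j"] \<open>n > 0\<close> by simp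
  qed
  also have "\<dots> = of_nat (2 * n) *\<^sub>C (A ^^ n) y"
    using \<open>n > 0\<close> by simp
  finally have "real (2 * n) * norm ((A ^^ n) y) \<le> n * (2 * cmod (1 - \<omega>) / m\<^sup>2 * norm y)"
    using norm_alternating_sum_le[of g "2 * cmod (1 - \<omega>) / m\<^sup>2 * norm y" n, OF g_diff]
    by (simp only: norm_scaleC norm_of_nat)
  then have "(2 * real n) * norm ((A ^^ n) y) \<le> (2 * real n) * (cmod (1 - \<omega>) / m\<^sup>2 * norm y)"
    by (simp add: mult.assoc mult.left_commute)
  then show ?thesis
    unfolding \<omega>_eq[symmetric] by (rule mult_left_le_imp_le) (use \<open>n > 0\<close> in simp)
qed

text \<open>Compactness of the circle: since \<open>A\<close> is norm-nonincreasing, the lower bound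
  \<open>d \<nu>\<close> at \<nu> persists with half its size on the disc of radius
  \<open>d \<nu> / 2\<close>, and finitely many such discs suffice.\<close>

lemma bounded_below_uniform_circle:
  fixes A :: "'a::complex_banach \<Rightarrow> 'a"
  assumes pb: "\<And>x. norm (A x) \<le> norm x"
    and lower: "\<And>\<mu>. cmod \<mu> = 1 \<Longrightarrow> \<exists>m>0. \<forall>y\<in>Y. m * norm y \<le> norm (y - \<mu> *\<^sub>C A y)"
  obtains m where "m > 0" "\<And>\<mu> y. cmod \<mu> = 1 \<Longrightarrow> y \<in> Y \<Longrightarrow> m * norm y \<le> norm (y - \<mu> *\<^sub>C A y)"
proof -
  obtain d where d: "\<And>\<mu>. cmod \<mu> = 1 \<Longrightarrow> d \<mu> > 0"
    "\<And>\<mu> y. cmod \<mu> = 1 \<Longrightarrow> y \<in> Y \<Longrightarrow> d \<mu> * norm y \<le> norm (y - \<mu> *\<^sub>C A y)"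
    using lower by metis
  have "sphere (0::complex) 1 \<subseteq> (\<Union>\<mu>\<in>sphere 0 1. ball \<mu> (d \<mu> / 2))"
    using d(1) by fastforce
  then obtain F where F: "F \<subseteq> sphere 0 1" "finite F" "sphere 0 1 \<subseteq> (\<Union>\<mu>\<in>F. ball \<mu> (d \<mu> / 2))"
    using compactE_image[OF compact_sphere, of "sphere 0 1" "\<lambda>\<mu>. ball \<mu> (d \<mu> / 2)" "0::complex" 1]
    by blast
  define m where "m = Min ((\<lambda>\<mu>. d \<mu> / 2) ` F)"
  have "1 \<in> sphere (0::complex) 1" by simp
  then have "F \<noteq> {}" using F(3) by blast
  have "m > 0"
    unfolding m_def using F d(1) \<open>F \<noteq> {}\<close> by (subst Min_gr_iff) auto
  moreover have "m * norm y \<le> norm (y - \<mu> *\<^sub>C A y)" if "cmod \<mu> = 1" "y \<in> Y" for \<mu> y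
  proof -
    have "\<mu> \<in> sphere 0 1" using that by simp
    then obtain \<nu> where \<nu>: "\<nu> \<in> F" "cmod (\<nu> - \<mu>) < d \<nu> / 2"
      using F(3) by (auto simp: dist_norm)
    have "cmod \<nu> = 1" using \<nu>(1) F(1) by auto
    have "y - \<nu> *\<^sub>C A y = (y - \<mu> *\<^sub>C A y) - (\<nu> - \<mu>) *\<^sub>C A y"
      by (simp add: scaleC.diff_left)
    then have "norm (y - \<nu> *\<^sub>C A y) \<le> norm (y - \<mu> *\<^sub>C A y) + cmod (\<nu> - \<mu>) * norm (A y)"
      by (metis norm_triangle_ineq4 norm_scaleC)
    moreover have "cmod (\<nu> - \<mu>) * norm (A y) \<le> d \<nu> / 2 * norm y"
      using \<nu>(2) pb[of y] d(1)[OF \<open>cmod \<nu> = 1\<close>] by (intro mult_mono) auto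
    moreover have "d \<nu> * norm y \<le> norm (y - \<nu> *\<^sub>C A y)"
      using d(2) \<open>cmod \<nu> = 1\<close> that by blast
    ultimately have "d \<nu> / 2 * norm y \<le> norm (y - \<mu> *\<^sub>C A y)"
      by (simp add: field_simps)
    moreover have "m \<le> d \<nu> / 2" unfolding m_def using F(2) \<nu>(1) by (intro Min_le) auto
    then have "m * norm y \<le> d \<nu> / 2 * norm y" by (rule mult_right_mono) simp
    ultimately show ?thesis by linarith
  qed
  ultimately show ?thesis using that by blast
qed

text \<open>Powers of \<open>A\<close> are the identity on the kernel of \<open>I - A\<close> and
  tend to 0 in norm on its range \<open>Y\<close> by the averaging estimate. The splitting is given
  only algebraically, so the projection \<open>P\<close> onto the kernel along \<open>Y\<close> must
  first be shown to be bounded; then \<open>A ^^ n\<close> tends to \<open>P\<close> in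
  norm.\<close>

theorem Cauchy_powers_of_direct_sum:
  fixes A :: "'a::complex_banach \<Rightarrow> 'a"
  assumes A: "bounded_clinear A"
    and pb: "\<And>n x. norm ((A ^^ n) x) \<le> norm x"
    and sum: "is_direct_sum (kernel (\<lambda>x. x - A x)) (range (\<lambda>x. x - A x))"
    and bij: "\<And>\<mu>. cmod \<mu> = 1 \<Longrightarrow> \<mu> \<noteq> 1 \<Longrightarrow> bij (\<lambda>x. \<mu> *\<^sub>C x - A x)"
    and "e > 0"
  shows "\<exists>N. \<forall>m\<ge>N. \<forall>n\<ge>N. \<forall>x. norm ((A ^^ m) x - (A ^^ n) x) \<le> e * norm x"
proof -
  have linA: "linear A" by (rule bounded_clinear_linear[OF A])
  define Y where "Y = range (\<lambda>x. x - A x)"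
  have linD: "linear (\<lambda>x. x - A x)"
    by (rule bounded_clinear_linear[OF bounded_clinear_diff[OF bounded_clinear_id A]])
  have subY: "subspace Y"
    unfolding Y_def by (rule linear_subspace_image[OF linD subspace_UNIV])
  have Y: "c *\<^sub>C y \<in> Y" "A y \<in> Y" if "y \<in> Y" for c y
  proof -
    obtain u where u: "y = u - A u" using \<open>y \<in> Y\<close> by (auto simp: Y_def)
    have "c *\<^sub>C y = c *\<^sub>C u - A (c *\<^sub>C u)" "A y = A u - A (A u)"
      by (simp_all add: u scaleC.diff_right bounded_clinear_scaleC[OF A] linear_diff[OF linA])
    then show "c *\<^sub>C y \<in> Y" "A y \<in> Y" by (auto simp: Y_def)
  qed
  have "\<exists>k. A k = k \<and> x - k \<in> Y" for x
  proof -
    obtain k v where "k \<in> kernel (\<lambda>x. x - A x)" "v \<in> Y" "x = k + v"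
      using sum unfolding is_direct_sum_def Y_def by blast
    then show ?thesis by (intro exI[of _ k]) (simp add: kernel_def)
  qed
  then obtain P where AP: "\<And>x. A (P x) = P x" and PY: "\<And>x. x - P x \<in> Y"
    by metis
  have zero: "k = 0" if "A k = k" "k \<in> Y" for k
    using sum that by (auto simp: is_direct_sum_def kernel_def Y_def)
  have P_unique: "P x = k" if "A k = k" "x - k \<in> Y" for x k
  proof -
    have "A (P x - k) = P x - k" by (simp add: AP that linear_diff[OF linA])
    moreover have "P x - k \<in> Y" using subspace_diff[OF subY that(2) PY[of x]] by simp
    ultimately show ?thesis using zero[of "P x - k"] by simp
  qed
  have P_add: "P (x + y) = P x + P y" for x y
  proof (rule P_unique)
    show "x + y - (P x + P y) \<in> Y"
      using subspace_add[OF subY PY[of x] PY[of y]] by (simp add: algebra_simps)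
  qed (simp add: AP linear_add[OF linA])
  have P_scaleR: "P (r *\<^sub>R x) = r *\<^sub>R P x" for r x
  proof (rule P_unique)
    show "r *\<^sub>R x - r *\<^sub>R P x \<in> Y"
      using subspace_scale[OF subY PY[of x], of r] by (simp add: scaleR_diff_right)
  qed (simp add: AP linear_cmul[OF linA])
  txt \<open>\<open>P\<close> is the limit of the Cesaro means of the powers of \<open>A\<close>.\<close>
  have P_norm: "norm (P x) \<le> norm x" for x
  proof (rule ccontr)
    assume "\<not> ?thesis"
    then have pos: "norm (P x) - norm x > 0" by simp
    obtain u where u: "x - P x = u - A u" using PY[of x] by (auto simp: Y_def)
    \<comment> \<open>The sum of the first \<open>n\<close> powers at \<open>x\<close> differs from
      \<open>n\<close> times \<open>P x\<close> by at most \<open>2 * norm u\<close>;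
      \<open>n\<close> is taken so large that this cannot compensate the supposed excess of
      \<open>norm (P x)\<close>.\<close>
    obtain n where n: "2 * norm u < real n * (norm (P x) - norm x)"
      using reals_Archimedean3[OF pos] by blast
    have fixed: "(A ^^ j) (P x) = P x" for j
      by (induction j) (simp_all add: AP)
    have linAj: "linear (A ^^ j)" for j
      by (rule bounded_clinear_linear[OF bounded_clinear_funpow[OF A]])
    have "(A ^^ j) x = P x + ((A ^^ j) u - (A ^^ Suc j) u)" for j
    proof -
      have "x = P x + (u - A u)" using u by (simp add: algebra_simps)
      then have "(A ^^ j) x = (A ^^ j) (P x + (u - A u))" by simp
      also have "\<dots> = P x + ((A ^^ j) u - (A ^^ j) (A u))"
        by (simp only: linear_add[OF linAj] linear_diff[OF linAj] fixed)
      finally show ?thesis by (simp add: funpow_swap1)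
    qed
    then have "(\<Sum>j<n. (A ^^ j) x) = (\<Sum>j<n. P x) + (\<Sum>j<n. (A ^^ j) u - (A ^^ Suc j) u)"
      by (simp only: sum.distrib)
    then have "real n *\<^sub>R P x = (\<Sum>j<n. (A ^^ j) x) - (u - (A ^^ n) u)"
      using sum_lessThan_telescope'[of "\<lambda>j. (A ^^ j) u" n] by (simp add: sum_constant_scaleR)
    then have "real n * norm (P x) \<le> norm (\<Sum>j<n. (A ^^ j) x) + norm (u - (A ^^ n) u)"
      using norm_triangle_ineq4[of "\<Sum>j<n. (A ^^ j) x" "u - (A ^^ n) u"]
        norm_scaleR[of "real n" "P x"] by simp
    also have "\<dots> \<le> real n * norm x + 2 * norm u"
    proof -
      have "norm (\<Sum>j<n. (A ^^ j) x) \<le> real n * norm x"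
        using sum_norm_le[of "{..<n}" "\<lambda>j. (A ^^ j) x" "\<lambda>_. norm x"] pb by simp
      then show ?thesis
        using norm_triangle_ineq4[of u "(A ^^ n) u"] pb[of n u] by linarith
    qed
    finally show False using n by (simp add: algebra_simps)
  qed
  have "bounded_linear P"
    by (rule bounded_linear_intro[where K = 1]) (simp_all add: P_add P_scaleR P_norm)
  have P0: "P y = 0" if "y \<in> Y" for y
    using P_unique[of 0 y] that by (simp add: linear_0[OF linA])
  \<comment> \<open>Adding \<open>P\<close> repairs the kernel of \<open>I - A\<close> and the
    missing part of its range. \<open>L\<close> is thus bijective, and it agrees with
    \<open>I - A\<close> on \<open>Y\<close>, where its lower bound is the one needed for
    \<open>\<mu> = 1\<close>.\<close>
  define L where "L x = x - A x + P x" for x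
  have L: "bounded_linear L"
    unfolding L_def using A \<open>bounded_linear P\<close>
    by (intro bounded_linear_add bounded_linear_sub bounded_linear_ident) (auto simp: bounded_clinear_def)
  have "bij L"
  proof (rule bijI)
    have "x = 0" if "L x = 0" for x
    proof -
      have "P x = - (x - A x)" using that minus_unique[of "x - A x" "P x"] by (simp only: L_def)
      moreover have "x - A x \<in> Y" by (auto simp: Y_def)
      ultimately have "P x \<in> Y" using subspace_neg[OF subY] by metis
      then have "P x = 0" using zero AP by blast
      then have "A x = x" using that by (simp add: L_def)
      then have "P x = x" by (intro P_unique) (simp_all add: subspace_0[OF subY])
      then show ?thesis using \<open>P x = 0\<close> by simp
    qed
    then show "inj L"
      by (simp add: linear_injective_0[OF bounded_linear.linear[OF L]])
    have "\<exists>x. y = L x" for y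
    proof -
      obtain u where u: "y - P y = u - A u" using PY[of y] by (auto simp: Y_def)
      have "P (u - P u) = 0" by (rule P0[OF PY])
      moreover have "P (P y) = P y" by (rule P_unique) (simp_all add: AP subspace_0[OF subY])
      ultimately have "L (u - P u + P y) = (u - A u) + P y"
        by (simp add: L_def P_add linear_add[OF linA] linear_diff[OF linA] AP)
      then show ?thesis using u by (metis diff_add_cancel)
    qed
    then show "surj L" by (auto simp: surj_def)
  qed
  obtain l where l: "l > 0" "\<And>x. l * norm x \<le> norm (L x)"
    using bounded_linear_bij_bounded_below[OF L \<open>bij L\<close>] by blast
  have "\<exists>m>0. \<forall>y\<in>Y. m * norm y \<le> norm (y - \<mu> *\<^sub>C A y)" if \<mu>: "cmod \<mu> = 1" for \<mu>
  proof (cases "\<mu> = 1")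
    case True
    have "l * norm y \<le> norm (y - A y)" if "y \<in> Y" for y
      using l(2)[of y] P0[OF that] by (simp add: L_def)
    then show ?thesis using True \<open>l > 0\<close> by auto
  next
    case False
    \<comment> \<open>Pulling out \<mu> turns \<open>I - \<mu> A\<close> into
      \<open>\<mu> (\<nu> I - A)\<close>, with \<nu> again on the circle and different from
      1.\<close>
    define \<nu> where "\<nu> = inverse \<mu>"
    have \<nu>: "cmod \<nu> = 1" "\<nu> \<noteq> 1" "\<mu> * \<nu> = 1"
      using \<mu> False by (auto simp: \<nu>_def norm_inverse intro: right_inverse)
    have "bounded_linear (\<lambda>x. \<nu> *\<^sub>C x - A x)"
      using bounded_clinear_diff[OF bounded_clinear_scale[OF bounded_clinear_id] A]
      by (simp add: bounded_clinear_def)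
    then obtain m where m: "m > 0" "\<And>x. m * norm x \<le> norm (\<nu> *\<^sub>C x - A x)"
      using bounded_linear_bij_bounded_below[OF _ bij[OF \<nu>(1,2)]] by metis
    have "m * norm y \<le> norm (y - \<mu> *\<^sub>C A y)" for y
    proof -
      have "y - \<mu> *\<^sub>C A y = \<mu> *\<^sub>C (\<nu> *\<^sub>C y - A y)"
        by (simp add: scaleC.diff_right scaleC_scaleC \<nu>(3))
      then show ?thesis using m(2)[of y] \<mu> by (simp add: norm_scaleC)
    qed
    then show ?thesis using \<open>m > 0\<close> by auto
  qed
  then obtain m where m: "m > 0"
    "\<And>\<mu> y. cmod \<mu> = 1 \<Longrightarrow> y \<in> Y \<Longrightarrow> m * norm y \<le> norm (y - \<mu> *\<^sub>C A y)"
    using bounded_below_uniform_circle[of A Y] pb[of 1] by auto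
  define c where "c n = cmod (1 - exp (of_real pi * \<i> / of_nat n)) / m\<^sup>2" for n :: nat
  have "(\<lambda>n. of_real pi * \<i> / of_nat n) \<longlonglongrightarrow> 0"
    by (rule lim_const_over_n)
  then have "c \<longlonglongrightarrow> cmod (1 - exp 0) / m\<^sup>2"
    unfolding c_def by (intro tendsto_intros) (use m(1) in auto)
  then have "\<forall>\<^sub>F n in sequentially. c n < e / 4"
    using \<open>e > 0\<close> by (intro order_tendstoD(2)) auto
  then obtain N where N: "\<And>n. n \<ge> N \<Longrightarrow> c n < e / 4"
    by (auto simp: eventually_sequentially)
  \<comment> \<open>\<open>Suc N\<close> makes \<open>n\<close> positive, as the averaging estimate
    requires; \<open>e / 4\<close> becomes \<open>e / 2\<close> because
    \<open>norm (x - P x)\<close> is at most \<open>2 * norm x\<close>.\<close>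
  have close: "norm ((A ^^ n) x - P x) \<le> e / 2 * norm x" if "n \<ge> Suc N" for n x
  proof -
    have "(A ^^ n) (P x) = P x" by (induction n) (simp_all add: AP)
    then have "(A ^^ n) x - P x = (A ^^ n) (x - P x)"
      by (simp add: linear_diff[OF bounded_clinear_linear[OF bounded_clinear_funpow[OF A]]])
    also have "norm \<dots> \<le> c n * norm (x - P x)"
      unfolding c_def
      by (rule norm_funpow_le_of_bounded_below[OF A subY Y pb m PY]) (use that in auto)
    also have "\<dots> \<le> e / 4 * (2 * norm x)"
      using N[of n] that norm_triangle_ineq4[of x "P x"] P_norm[of x] \<open>e > 0\<close>
      by (intro mult_mono) auto
    finally show ?thesis by simp
  qed
  have "norm ((A ^^ m) x - (A ^^ n) x) \<le> e * norm x" if "m \<ge> Suc N" "n \<ge> Suc N" for m n x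
    using close[OF that(1), of x] close[OF that(2), of x]
      norm_triangle_ineq4[of "(A ^^ m) x - P x" "(A ^^ n) x - P x"] by (simp add: algebra_simps)
  then show ?thesis by blast
qed


section \<open>Cauchy estimates for holomorphic maps\<close>

text \<open>Cauchy's inequality is applied on circles of radius \<open>s < r\<close>, whose closed
  discs lie in the open unit disc; the bound at \<open>r\<close> follows as \<open>s\<close>
  increases to \<open>r\<close>.\<close>

lemma Cauchy_coefficient_bound:
  assumes hol: "f holomorphic_on ball 0 1" and bound: "\<And>z. cmod z < r \<Longrightarrow> cmod (f z) \<le> M"
    and r: "0 < r" "r \<le> 1"
  shows "cmod ((deriv ^^ n) f 0 / fact n) \<le> M / r ^ n"
proof -
  let ?a = "cmod ((deriv ^^ n) f 0 / fact n)"
  have "?a * s ^ n \<le> M" if s: "0 < s" "s < r" for s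
  proof -
    have "cmod ((deriv ^^ n) f 0) \<le> fact n * M / s ^ n"
    proof (rule Cauchy_inequality)
      show "f holomorphic_on ball 0 s" "continuous_on (cball 0 s) f"
        using s r by (auto intro!: holomorphic_on_subset[OF hol] holomorphic_on_imp_continuous_on)
    qed (use s bound in auto)
    then show ?thesis using s by (simp add: norm_divide field_simps)
  qed
  then have "\<forall>\<^sub>F s in at_left r. ?a * s ^ n \<le> M"
    using eventually_at_left_real[OF r(1)] by (auto elim!: eventually_mono)
  moreover have "((\<lambda>s. ?a * s ^ n) \<longlongrightarrow> ?a * r ^ n) (at_left r)"
    by (intro tendsto_intros)
  ultimately have "?a * r ^ n \<le> M"
    by (intro tendsto_upperbound) auto
  then show ?thesis using r by (simp add: field_simps)
qed

text \<open>All Taylor coefficients are at most \<open>M\<close> in modulus, so the tail is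
  dominated by a geometric series.\<close>

lemma Taylor_remainder_bound:
  assumes hol: "f holomorphic_on ball 0 1" and bound: "\<And>z. cmod z < 1 \<Longrightarrow> cmod (f z) \<le> M"
    and z: "cmod z < 1"
  shows "cmod (f z - (\<Sum>k<K. (deriv ^^ k) f 0 / fact k * z ^ k)) \<le> M * cmod z ^ K / (1 - cmod z)"
proof -
  let ?a = "\<lambda>k. (deriv ^^ k) f 0 / fact k * z ^ k"
  have "?a sums f z"
    using holomorphic_power_series[OF hol, of z] z by simp
  then have tail: "(\<lambda>k. ?a (k + K)) sums (f z - (\<Sum>k<K. ?a k))"
    by (rule sums_split_initial_segment)
  have geo: "(\<lambda>k. M * cmod z ^ K * cmod z ^ k) sums (M * cmod z ^ K * (1 / (1 - cmod z)))"
    using z by (intro sums_mult geometric_sums) simp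
  have le: "cmod (?a (k + K)) \<le> M * cmod z ^ K * cmod z ^ k" for k
  proof -
    have "cmod (?a (k + K)) = cmod ((deriv ^^ (k + K)) f 0 / fact (k + K)) * cmod z ^ (k + K)"
      by (simp only: norm_mult norm_power)
    also have "\<dots> \<le> M * cmod z ^ (k + K)"
      using Cauchy_coefficient_bound[OF hol bound, of 1 "k + K"]
      by (intro mult_right_mono) auto
    finally show ?thesis by (simp add: power_add mult_ac)
  qed
  then show ?thesis
    using norm_sums_le[OF tail geo le] by simp
qed

section \<open>Holomorphic maps between Banach spaces and their slices along complex lines\<close>

lemma HolD:
  assumes "f \<in> Hol D W" "x \<in> D"
  obtains f' where "(f has_derivative f') (at x)" "bounded_clinear f'"
  using assms unfolding Hol_def by blast

lemma Hol_in: "f \<in> Hol D W \<Longrightarrow> x \<in> D \<Longrightarrow> f x \<in> W"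
  unfolding Hol_def by auto

lemma HolI:
  assumes "\<And>x. x \<in> D \<Longrightarrow> f x \<in> W"
    and "\<And>x. x \<in> D \<Longrightarrow> \<exists>f'. (f has_derivative f') (at x) \<and> bounded_clinear f'"
  shows "f \<in> Hol D W"
  using assms unfolding Hol_def by auto

lemma Hol_compose:
  assumes g: "g \<in> Hol D W" and f: "f \<in> Hol C D"
  shows "g \<circ> f \<in> Hol C W"
proof (rule HolI)
  fix x assume x: "x \<in> C"
  then have fx: "f x \<in> D" by (rule Hol_in[OF f])
  show "(g \<circ> f) x \<in> W" using Hol_in[OF g fx] by simp
  obtain f' g' where "(f has_derivative f') (at x)" "bounded_clinear f'"
    "(g has_derivative g') (at (f x))" "bounded_clinear g'"
    by (meson HolD f g x fx)
  then show "\<exists>d. (g \<circ> f has_derivative d) (at x) \<and> bounded_clinear d"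
    using diff_chain_at[of f f' x g g'] bounded_clinear_compose[of g' f'] by (auto simp: o_def)
qed

lemma Hol_mono: "f \<in> Hol D W \<Longrightarrow> C \<subseteq> D \<Longrightarrow> W \<subseteq> V \<Longrightarrow> f \<in> Hol C V"
  unfolding Hol_def by blast

lemma Hol_diff:
  assumes "f \<in> Hol D W" "g \<in> Hol D W'" "\<And>x. x \<in> D \<Longrightarrow> f x - g x \<in> V"
  shows "(\<lambda>x. f x - g x) \<in> Hol D V"
proof (rule HolI)
  fix x assume x: "x \<in> D"
  obtain f' g' where "(f has_derivative f') (at x)" "bounded_clinear f'"
    "(g has_derivative g') (at x)" "bounded_clinear g'"
    by (meson HolD assms(1,2) x)
  then show "\<exists>d. ((\<lambda>x. f x - g x) has_derivative d) (at x) \<and> bounded_clinear d"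
    using has_derivative_diff bounded_clinear_diff by blast
qed (rule assms(3))

text \<open>Restriction to a complex line followed by a functional yields a scalar function of one
  variable, to which the classical estimates apply; norming functionals carry them back to
  \<open>f\<close>.\<close>

lemma has_field_derivative_slice:
  fixes f :: "'a::complex_banach \<Rightarrow> 'b::complex_banach" and L :: "'b \<Rightarrow> complex"
  assumes f: "(f has_derivative f') (at (a + \<zeta> *\<^sub>C v))" "bounded_clinear f'"
    and L: "bounded_clinear L"
  shows "((\<lambda>\<zeta>. L (f (a + \<zeta> *\<^sub>C v))) has_field_derivative L (f' v)) (at \<zeta>)"
proof -
  have "((\<lambda>\<zeta>. a + \<zeta> *\<^sub>C v) has_derivative (\<lambda>h. 0 + h *\<^sub>C v)) (at \<zeta>)"
    by (intro has_derivative_add has_derivative_const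
        bounded_linear.has_derivative[OF scaleC.bounded_linear_left] has_derivative_ident)
  then have "((\<lambda>\<zeta>. f (a + \<zeta> *\<^sub>C v)) has_derivative (\<lambda>h. f' (0 + h *\<^sub>C v))) (at \<zeta>)"
    using diff_chain_at[of "\<lambda>\<zeta>. a + \<zeta> *\<^sub>C v" "\<lambda>h. 0 + h *\<^sub>C v" \<zeta> f f'] f(1) by (simp add: o_def)
  then have "((\<lambda>\<zeta>. L (f (a + \<zeta> *\<^sub>C v))) has_derivative (\<lambda>h. L (f' (0 + h *\<^sub>C v)))) (at \<zeta>)"
    using bounded_linear.has_derivative L by (auto simp: bounded_clinear_def)
  moreover have "(\<lambda>h. L (f' (0 + h *\<^sub>C v))) = (*) (L (f' v))"
    by (simp add: fun_eq_iff bounded_clinear_scaleC[OF f(2)] bounded_clinear_scaleC[OF L]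
        scaleC_complex_def mult.commute)
  ultimately show ?thesis by (simp add: has_field_derivative_def)
qed

lemma slice_in_ball:
  assumes "norm v \<le> r" "cmod \<zeta> < 1" "0 < r"
  shows "a + \<zeta> *\<^sub>C v \<in> ball a r"
proof -
  have "cmod \<zeta> * norm v \<le> cmod \<zeta> * r" using assms by (simp add: mult_left_mono)
  also have "\<dots> < 1 * r" using assms by (intro mult_strict_right_mono)
  finally show ?thesis by (simp add: dist_norm norm_scaleC)
qed

lemma holomorphic_on_slice:
  fixes f :: "'a::complex_banach \<Rightarrow> 'b::complex_banach" and L :: "'b \<Rightarrow> complex"
  assumes f: "f \<in> Hol (ball a r) W" and L: "bounded_clinear L" and v: "norm v \<le> r" "0 < r"
  shows "(\<lambda>\<zeta>. L (f (a + \<zeta> *\<^sub>C v))) holomorphic_on ball 0 1"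
  unfolding holomorphic_on_open[OF open_ball]
proof
  fix \<zeta> :: complex assume "\<zeta> \<in> ball 0 1"
  then have "a + \<zeta> *\<^sub>C v \<in> ball a r" using v by (intro slice_in_ball) auto
  then obtain f' where "(f has_derivative f') (at (a + \<zeta> *\<^sub>C v))" "bounded_clinear f'"
    using HolD[OF f] by blast
  then show "\<exists>g'. ((\<lambda>\<zeta>. L (f (a + \<zeta> *\<^sub>C v))) has_field_derivative g') (at \<zeta>)"
    using has_field_derivative_slice L by blast
qed

section \<open>Cauchy, Schwarz and Lipschitz estimates in Banach spaces\<close>

lemma Hol_cball_bound: "f \<in> Hol D (cball 0 M) \<Longrightarrow> x \<in> D \<Longrightarrow> norm (f x) \<le> M"
  unfolding Hol_def by auto

context
  fixes f :: "'a::complex_banach \<Rightarrow> 'b::complex_banach" and f' a r M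
  assumes f: "f \<in> Hol (ball a r) (cball 0 M)" and r: "0 < r"
    and f': "(f has_derivative f') (at a)" "bounded_clinear f'"
begin

text \<open>In a direction \<open>u\<close> of norm \<open>r\<close>, followed by a functional that
  norms \<open>f' u\<close>, the slice is bounded by \<open>M\<close> on the unit disc and has
  derivative \<open>norm (f' u)\<close> at 0.\<close>

lemma Cauchy_estimate_derivative: "norm (f' v) \<le> M / r * norm v"
proof (cases "v = 0")
  case True
  then show ?thesis by (simp add: linear_0[OF bounded_clinear_linear[OF f'(2)]])
next
  case False
  define u where "u = (r / norm v) *\<^sub>R v"
  have u: "norm u = r" using False r by (simp add: u_def)
  obtain L where L: "bounded_clinear L" "\<And>x. cmod (L x) \<le> norm x" "L (f' u) = of_real (norm (f' u))"
    using norming_functional[of "f' u"] by blast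
  let ?g = "\<lambda>\<zeta>. L (f (a + \<zeta> *\<^sub>C u))"
  have "(?g has_field_derivative L (f' u)) (at 0)"
    by (rule has_field_derivative_slice) (simp_all add: f' L(1))
  then have "deriv ?g 0 = L (f' u)" by (rule DERIV_imp_deriv)
  moreover have "cmod ((deriv ^^ 1) ?g 0 / fact 1) \<le> M / 1 ^ 1"
  proof (rule Cauchy_coefficient_bound)
    show "?g holomorphic_on ball 0 1" using holomorphic_on_slice[OF f L(1)] u r by simp
    show "cmod (?g \<zeta>) \<le> M" if "cmod \<zeta> < 1" for \<zeta>
      using order_trans[OF L(2) Hol_cball_bound[OF f slice_in_ball]] u r that by simp
  qed auto
  ultimately have "norm (f' u) \<le> M" using L(3) by simp
  moreover have "f' u = (r / norm v) *\<^sub>R f' v"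
    by (simp add: u_def linear_cmul[OF bounded_clinear_linear[OF f'(2)]])
  ultimately show ?thesis using False r by (simp add: field_simps)
qed

text \<open>On the slice the increment \<open>v\<close> corresponds to the parameter
  \<open>t = norm v / r\<close>, which is at most 1/2, so the Taylor tail of order two is at most
  \<open>2 * M * t\<^sup>2\<close>.\<close>

lemma Cauchy_estimate_remainder:
  assumes "norm v \<le> r / 2"
  shows "norm (f (a + v) - f a - f' v) \<le> 2 * M / r\<^sup>2 * (norm v)\<^sup>2"
proof (cases "v = 0")
  case True
  then show ?thesis by (simp add: linear_0[OF bounded_clinear_linear[OF f'(2)]])
next
  case False
  define t where "t = norm v / r"
  define u where "u = inverse t *\<^sub>R v"
  have t: "0 < t" "t \<le> 1/2" using False r assms by (auto simp: t_def field_simps)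
  have u: "norm u = r" "v = of_real t *\<^sub>C u"
    using False r by (simp_all only: u_def t_def scaleC_of_real) simp_all
  let ?y = "f (a + v) - f a - f' v"
  obtain L where L: "bounded_clinear L" "\<And>x. cmod (L x) \<le> norm x" "L ?y = of_real (norm ?y)"
    using norming_functional[of ?y] by blast
  let ?g = "\<lambda>\<zeta>. L (f (a + \<zeta> *\<^sub>C u))"
  have "(?g has_field_derivative L (f' u)) (at 0)"
    by (rule has_field_derivative_slice) (simp_all add: f' L(1))
  then have deriv: "deriv ?g 0 = L (f' u)" by (rule DERIV_imp_deriv)
  have M: "cmod (?g \<zeta>) \<le> M" if "cmod \<zeta> < 1" for \<zeta>
    using order_trans[OF L(2) Hol_cball_bound[OF f slice_in_ball]] u r that by simp
  have "cmod (?g t - (\<Sum>k<2. (deriv ^^ k) ?g 0 / fact k * of_real t ^ k))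
      \<le> M * cmod t ^ 2 / (1 - cmod t)"
  proof (rule Taylor_remainder_bound)
    show "?g holomorphic_on ball 0 1" using holomorphic_on_slice[OF f L(1)] u r by simp
  qed (use t M in auto)
  moreover have "?g t - (\<Sum>k<2. (deriv ^^ k) ?g 0 / fact k * of_real t ^ k) = L ?y"
    by (simp add: lessThan_nat_numeral lessThan_Suc deriv linear_diff[OF bounded_clinear_linear[OF L(1)]]
        u(2) bounded_clinear_scaleC[OF f'(2)] bounded_clinear_scaleC[OF L(1)] scaleC_complex_def
        numeral_2_eq_2 mult.commute)
  ultimately have "norm ?y \<le> M * t\<^sup>2 / (1 - t)" using t L(3) by simp
  also have "\<dots> \<le> M * t\<^sup>2 / (1 / 2)"
    using t M[of 0] order_trans[OF norm_ge_zero M[of 0]] by (intro divide_left_mono) auto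
  also have "\<dots> = 2 * M / r\<^sup>2 * (norm v)\<^sup>2" by (simp add: t_def power_divide)
  finally show ?thesis .
qed

end

text \<open>Along a complex line the first \<open>K\<close> Taylor coefficients are controlled by
  the bound \<open>e\<close> on the small ball, the tail by the global bound \<open>M\<close>.
  Fixing \<open>K\<close> first and then \<open>e\<close> carries smallness near 0 to every smaller
  concentric ball.\<close>

lemma norm_le_of_small_near_zero:
  fixes f :: "'a::complex_banach \<Rightarrow> 'b::complex_banach"
  assumes f: "f \<in> Hol unit_ball (cball 0 M)" and d: "0 < d" "d \<le> 1"
    and small: "\<And>x. norm x < d \<Longrightarrow> norm (f x) \<le> e" and x: "norm x < 1"
  shows "norm (f x) \<le> e * (\<Sum>k<K. (norm x / d) ^ k) + M * norm x ^ K / (1 - norm x)"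
proof -
  \<comment> \<open>For \<open>x = 0\<close> the convention \<open>inverse 0 = 0\<close> gives
    \<open>u = 0\<close>, hence only \<open>norm u \<le> 1\<close>.\<close>
  define u where "u = inverse (norm x) *\<^sub>R x"
  have u: "norm u \<le> 1" "x = of_real (norm x) *\<^sub>C u"
    by (cases "x = 0"; simp add: u_def scaleC_of_real)+
  obtain L where L: "bounded_clinear L" "\<And>y. cmod (L y) \<le> norm y" "L (f x) = of_real (norm (f x))"
    using norming_functional[of "f x"] by blast
  let ?g = "\<lambda>\<zeta>. L (f (0 + \<zeta> *\<^sub>C u))" and ?z = "complex_of_real (norm x)"
  have hol: "?g holomorphic_on ball 0 1" using holomorphic_on_slice[OF f L(1) u(1)] by simp
  have M: "cmod (?g \<zeta>) \<le> M" if "cmod \<zeta> < 1" for \<zeta>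
    using order_trans[OF L(2) Hol_cball_bound[OF f slice_in_ball]] u that by simp
  have small_g: "cmod (?g \<zeta>) \<le> e" if "cmod \<zeta> < d" for \<zeta>
  proof -
    have "norm (\<zeta> *\<^sub>C u) \<le> cmod \<zeta> * 1" using mult_left_mono[OF u(1), of "cmod \<zeta>"] by (simp add: norm_scaleC)
    then show ?thesis using order_trans[OF L(2) small] that by simp
  qed
  let ?S = "\<Sum>k<K. (deriv ^^ k) ?g 0 / fact k * ?z ^ k"
  have "cmod (?g ?z - ?S) \<le> M * cmod ?z ^ K / (1 - cmod ?z)"
    by (rule Taylor_remainder_bound[OF hol M]) (use x in auto)
  moreover have "cmod ?S \<le> (\<Sum>k<K. e * (norm x / d) ^ k)"
  proof (rule sum_norm_le)
    fix k
    have "cmod ((deriv ^^ k) ?g 0 / fact k) * norm x ^ k \<le> e / d ^ k * norm x ^ k"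
      by (intro mult_right_mono Cauchy_coefficient_bound[OF hol small_g] d) auto
    also have "e / d ^ k * norm x ^ k = e * (norm x / d) ^ k" by (simp add: power_divide)
    finally show "cmod ((deriv ^^ k) ?g 0 / fact k * ?z ^ k) \<le> e * (norm x / d) ^ k"
      by (simp only: norm_mult norm_power norm_of_real abs_norm_cancel)
  qed
  moreover have "cmod (?g ?z) \<le> cmod ?S + cmod (?g ?z - ?S)"
    using norm_triangle_ineq[of ?S "?g ?z - ?S"] by simp
  moreover have "cmod (?g ?z) = norm (f x)"
    using L(3) u(2) by simp
  ultimately show ?thesis by (simp add: sum_distrib_left)
qed

text \<open>The scalar Schwarz lemma, applied to the slice through \<open>x\<close> and a functional
  that norms \<open>f x\<close>.\<close>

lemma Schwarz_norm:
  fixes f :: "'a::complex_banach \<Rightarrow> 'b::complex_banach"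
  assumes f: "f \<in> Hol unit_ball unit_ball" and "f 0 = 0" and x: "norm x < 1"
  shows "norm (f x) \<le> norm x"
proof -
  define u where "u = inverse (norm x) *\<^sub>R x"
  have u: "norm u \<le> 1" "x = of_real (norm x) *\<^sub>C u"
    by (cases "x = 0"; simp add: u_def scaleC_of_real)+
  obtain L where L: "bounded_clinear L" "\<And>y. cmod (L y) \<le> norm y" "L (f x) = of_real (norm (f x))"
    using norming_functional[of "f x"] by blast
  let ?g = "\<lambda>\<zeta>. L (f (0 + \<zeta> *\<^sub>C u))"
  have "cmod (?g (of_real (norm x))) \<le> cmod (of_real (norm x))"
  proof (rule Schwarz_Lemma(1))
    show "?g holomorphic_on ball 0 1" using holomorphic_on_slice[OF f L(1) u(1)] by simp
    show "?g 0 = 0" using \<open>f 0 = 0\<close> by (simp add: linear_0[OF bounded_clinear_linear[OF L(1)]])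
    show "cmod (?g \<zeta>) < 1" if "cmod \<zeta> < 1" for \<zeta>
    proof -
      have "f (0 + \<zeta> *\<^sub>C u) \<in> unit_ball"
        by (intro Hol_in[OF f] slice_in_ball u(1) that) simp
      then show ?thesis using L(2)[of "f (0 + \<zeta> *\<^sub>C u)"] by simp
    qed
  qed (use x in simp)
  then show ?thesis using L(3) u(2) by simp
qed

text \<open>Around each point of the half ball a ball of radius 1/2 fits into the unit ball, so the
  Cauchy estimate bounds the derivative by \<open>2 * M\<close>; the mean value inequality does the
  rest.\<close>

lemma Lipschitz_half_ball:
  fixes f :: "'a::complex_banach \<Rightarrow> 'b::complex_banach"
  assumes f: "f \<in> Hol unit_ball (cball 0 M)" and xy: "norm x < 1/2" "norm y < 1/2"
  shows "norm (f x - f y) \<le> 2 * M * norm (x - y)"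
proof -
  have "\<forall>z\<in>unit_ball. \<exists>F. (f has_derivative F) (at z) \<and> bounded_clinear F"
    using f by (simp add: Hol_def)
  then obtain F where F: "\<And>z. z \<in> unit_ball \<Longrightarrow> (f has_derivative F z) (at z)"
    "\<And>z. z \<in> unit_ball \<Longrightarrow> bounded_clinear (F z)"
    by metis
  show ?thesis
  proof (rule differentiable_bound[OF convex_ball[of 0 "1/2"]])
    fix z :: 'a assume z: "z \<in> ball 0 (1/2)"
    then have z1: "z \<in> unit_ball" by simp
    show "(f has_derivative F z) (at z within ball 0 (1/2))"
      by (rule has_derivative_at_withinI[OF F(1)[OF z1]])
    have "ball z (1/2) \<subseteq> unit_ball"
    proof
      fix w assume "w \<in> ball z (1/2)"
      then show "w \<in> unit_ball"
        using z norm_triangle_ineq[of z "w - z"] by (simp add: dist_norm norm_minus_commute)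
    qed
    then have "f \<in> Hol (ball z (1/2)) (cball 0 M)" by (rule Hol_mono[OF f]) simp
    from Cauchy_estimate_derivative[OF this _ F[OF z1]]
    have F_le: "norm (F z v) \<le> 2 * M * norm v" for v by (simp add: mult_ac)
    have "0 \<le> M" using Hol_cball_bound[OF f z1] norm_ge_zero order_trans by blast
    then show "onorm (F z) \<le> 2 * M" by (intro onorm_bound F_le) simp
  qed (use xy in auto)
qed

text \<open>The constant does not depend on the map, which is what makes the lemma applicable to all
  iterates of a self-map of the ball at once.\<close>

lemma linearization_Lipschitz:
  fixes f :: "'a::complex_banach \<Rightarrow> 'b::complex_banach"
  assumes f: "f \<in> Hol unit_ball (cball 0 1)"
    and f': "(f has_derivative f') (at 0)" "bounded_clinear f'"
    and r: "0 < r" "r \<le> 1/4" and xy: "norm x < r" "norm y < r"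
  shows "norm (f x - f y - f' (x - y)) \<le> 8 * r * norm (x - y)"
proof -
  \<comment> \<open>Scaling by \<open>1 / (2 * r)\<close> brings \<open>x\<close> and
    \<open>y\<close> into the half ball, and they reappear on the slices through \<open>u\<close>
    and \<open>v\<close> at the parameter \<open>2 * r\<close>, at most 1/2.\<close>
  define R where "R = 1 / (2 * r)"
  define u v where "u = R *\<^sub>R x" and "v = R *\<^sub>R y"
  have R: "R > 0" "R * r = 1/2" "1 / R = 2 * r" using r by (auto simp: R_def)
  have scale: "norm (R *\<^sub>R z) < 1/2" if "norm z < r" for z :: 'a
    using mult_strict_left_mono[OF that R(1)] R by simp
  then have uv: "norm u < 1/2" "norm v < 1/2" using xy by (auto simp: u_def v_def)
  have xu: "x = of_real (2 * r) *\<^sub>C u" "y = of_real (2 * r) *\<^sub>C v"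
    using r by (simp_all only: u_def v_def R_def scaleC_of_real) simp_all
  let ?y = "f x - f y - f' (x - y)"
  obtain L where L: "bounded_clinear L" "\<And>x. cmod (L x) \<le> norm x" "L ?y = of_real (norm ?y)"
    using norming_functional[of ?y] by blast
  note linL = bounded_clinear_linear[OF L(1)] and linf' = bounded_clinear_linear[OF f'(2)]
  \<comment> \<open>The Taylor remainder is taken for the difference of two slices. Its sup bound is
    proportional to \<open>norm (u - v)\<close>, which makes the result a Lipschitz
    estimate.\<close>
  define g where "g \<zeta> = L (f (0 + \<zeta> *\<^sub>C u)) - L (f (0 + \<zeta> *\<^sub>C v))" for \<zeta>
  have hol: "g holomorphic_on ball 0 1"
    unfolding g_def using uv by (intro holomorphic_on_diff holomorphic_on_slice[OF f L(1)]) auto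
  have "(g has_field_derivative L (f' u) - L (f' v)) (at 0)"
    unfolding g_def
    by (intro DERIV_diff has_field_derivative_slice L(1) f'(2)) (simp_all add: f'(1))
  then have deriv: "deriv g 0 = L (f' u) - L (f' v)" by (rule DERIV_imp_deriv)
  have bound: "cmod (g \<zeta>) \<le> 2 * norm (u - v)" if "cmod \<zeta> < 1" for \<zeta>
  proof -
    have in_half: "norm (\<zeta> *\<^sub>C w) < 1/2" if "norm w < 1/2" for w :: 'a
      using mult_mono[of "cmod \<zeta>" 1 "norm w" "norm w"] \<open>cmod \<zeta> < 1\<close> that by (simp add: norm_scaleC)
    have "cmod (g \<zeta>) \<le> norm (f (\<zeta> *\<^sub>C u) - f (\<zeta> *\<^sub>C v))"
      using L(2)[of "f (\<zeta> *\<^sub>C u) - f (\<zeta> *\<^sub>C v)"] by (simp add: g_def linear_diff[OF linL])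
    also have "\<dots> \<le> 2 * 1 * norm (\<zeta> *\<^sub>C u - \<zeta> *\<^sub>C v)"
      by (rule Lipschitz_half_ball[OF f in_half in_half]) (use uv in auto)
    also have "\<dots> = cmod \<zeta> * (2 * norm (u - v))"
      by (simp add: scaleC.diff_right[symmetric] norm_scaleC)
    also have "\<dots> \<le> 1 * (2 * norm (u - v))"
      using that by (intro mult_right_mono) auto
    finally show ?thesis by simp
  qed
  have "cmod (g (of_real (2 * r)) - (\<Sum>k<2. (deriv ^^ k) g 0 / fact k * of_real (2 * r) ^ k))
      \<le> 2 * norm (u - v) * cmod (of_real (2 * r)) ^ 2 / (1 - cmod (of_real (2 * r)))"
    using r by (intro Taylor_remainder_bound hol bound) auto
  moreover have "g (of_real (2 * r)) - (\<Sum>k<2. (deriv ^^ k) g 0 / fact k * of_real (2 * r) ^ k) = L ?y"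
  proof -
    have "f' (x - y) = of_real (2 * r) *\<^sub>C (f' u - f' v)"
      using xu by (simp only: linear_diff[OF linf'] bounded_clinear_scaleC[OF f'(2)] scaleC.diff_right)
    then have "L ?y = L (f x) - L (f y) - (L (f' u) - L (f' v)) * of_real (2 * r)"
      by (simp only: linear_diff[OF linL] bounded_clinear_scaleC[OF L(1)] scaleC_complex_def mult.commute)
    moreover have "g (of_real (2 * r)) = L (f x) - L (f y)"
      by (simp only: g_def add_0 xu[symmetric])
    moreover have "g 0 = 0" by (simp add: g_def)
    ultimately show ?thesis by (simp add: numeral_2_eq_2 deriv)
  qed
  ultimately have "norm ?y \<le> 2 * norm (u - v) * (2 * r)\<^sup>2 / (1 - 2 * r)"
    using L(3) r by simp
  also have "\<dots> \<le> 2 * norm (u - v) * (2 * r)\<^sup>2 / (1 / 2)"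
    using r by (intro divide_left_mono) auto
  also have "norm (u - v) = R * norm (x - y)"
    using R by (simp add: u_def v_def scaleR_diff_right[symmetric])
  also have "2 * (R * norm (x - y)) * (2 * r)\<^sup>2 / (1 / 2) = 8 * r * norm (x - y)"
    using r by (simp add: R_def power2_eq_square)
  finally show ?thesis .
qed


section \<open>Iterates of a holomorphic self-map of the ball\<close>

lemma converges_inside_ballD:
  "converges_inside_ball F \<phi> \<Longrightarrow> r < 1 \<Longrightarrow> uniform_limit (cball 0 r) F \<phi> sequentially"
  unfolding converges_inside_ball_def by (meson closed_cball order_refl)

context
  fixes F :: "'a::complex_banach \<Rightarrow> 'a" and A
  assumes F: "F \<in> Hol unit_ball unit_ball" and F0: "F 0 = 0"
    and A: "(F has_derivative A) (at 0)" "bounded_clinear A"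
begin

lemma funpow_Hol: "F ^^ n \<in> Hol unit_ball unit_ball"
proof (induction n)
  case 0
  show ?case
    by (auto simp: Hol_def id_def intro!: exI[of _ "\<lambda>x. x"] has_derivative_ident bounded_clinear_id)
next
  case (Suc n)
  show ?case using Hol_compose[OF F Suc.IH] by (simp add: o_def)
qed

lemma funpow_zero: "(F ^^ n) 0 = 0"
  by (induction n) (simp_all add: F0)

lemma funpow_has_derivative: "(F ^^ n has_derivative A ^^ n) (at 0)"
proof (induction n)
  case (Suc n)
  have "(F has_derivative A) (at ((F ^^ n) 0))" using A by (simp add: funpow_zero)
  from diff_chain_at[OF Suc this] show ?case by (simp add: o_def)
qed (simp add: id_def has_derivative_ident)

lemma norm_funpow_le: "norm x < 1 \<Longrightarrow> norm ((F ^^ n) x) \<le> norm x"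
  by (intro Schwarz_norm funpow_Hol funpow_zero)

lemma norm_funpow_derivative_le: "norm ((A ^^ n) x) \<le> norm x"
proof -
  have "F ^^ n \<in> Hol unit_ball (cball 0 1)" by (rule Hol_mono[OF funpow_Hol]) auto
  from Cauchy_estimate_derivative[OF this _ funpow_has_derivative bounded_clinear_funpow[OF A(2)]]
  show ?thesis by simp
qed

lemma Hol_funpow_diff: "(\<lambda>x. (F ^^ m) x - (F ^^ n) x) \<in> Hol unit_ball (cball 0 2)"
proof (rule Hol_diff[OF funpow_Hol funpow_Hol])
  show "(F ^^ m) x - (F ^^ n) x \<in> cball 0 2" if "x \<in> unit_ball" for x
    using that norm_triangle_ineq4[of "(F ^^ m) x" "(F ^^ n) x"] norm_funpow_le[of x m] norm_funpow_le[of x n]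
    by simp
qed

text \<open>For a fixed \<open>p\<close>, the increments \<open>v n = F\<^sup>n\<^sup>+\<^sup>p x - F\<^sup>n x\<close> satisfy
  \<open>v (n + j) = A\<^sup>j (v n) + O(\<epsilon>) (v n)\<close>, so for large \<open>j\<close> they are all close to
  \<open>P (v n)\<close>, where \<open>P = A\<^sup>J\<close>. The orbit is bounded while \<open>k\<close> such increments add up to almost
  \<open>k P (v n)\<close>, whence \<open>P (v n)\<close> is itself \<open>O(\<epsilon>) (v n)\<close>.\<close>

lemma increment_halves:
  assumes J: "\<And>j x. j \<ge> J \<Longrightarrow> norm ((A ^^ j) x - (A ^^ J) x) \<le> 1/8 * norm x"
    and x: "norm x < 1/64" and j: "j \<ge> J"
  shows "norm ((F ^^ (n + j + p)) x - (F ^^ (n + j)) x) \<le> 1/2 * norm ((F ^^ (n + p)) x - (F ^^ n) x)"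
proof -
  define v where "v n = (F ^^ (n + p)) x - (F ^^ n) x" for n
  have orbit: "norm ((F ^^ n) x) < 1/64" for n
    using norm_funpow_le[of x n] x by simp
  \<comment> \<open>On the ball of radius 1/64 the linearization error has Lipschitz constant
    \<open>8 / 64 = 1/8\<close>.\<close>
  have lin: "norm (v (n + j) - (A ^^ j) (v n)) \<le> 1/8 * norm (v n)" for j
  proof -
    have "v (n + j) = (F ^^ j) ((F ^^ (n + p)) x) - (F ^^ j) ((F ^^ n) x)"
      unfolding v_def by (simp flip: funpow_add[THEN fun_cong, unfolded o_apply] add: add_ac)
    moreover have "F ^^ j \<in> Hol unit_ball (cball 0 1)" by (rule Hol_mono[OF funpow_Hol]) auto
    ultimately show ?thesis
      using linearization_Lipschitz[OF _ funpow_has_derivative bounded_clinear_funpow[OF A(2)],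
          of j "1/64" "(F ^^ (n + p)) x" "(F ^^ n) x"] orbit by (simp add: v_def)
  qed
  let ?w = "(A ^^ J) (v n)"
  have close: "norm (v (n + j) - ?w) \<le> 1/4 * norm (v n)" if "j \<ge> J" for j
    using lin[of j] J[OF that, of "v n"]
      norm_triangle_ineq[of "v (n + j) - (A ^^ j) (v n)" "(A ^^ j) (v n) - ?w"] by simp
  have "norm ?w \<le> 1/4 * norm (v n)"
  proof (rule ccontr)
    assume "\<not> ?thesis"
    then have pos: "norm ?w - 1/4 * norm (v n) > 0" by simp
    obtain k where k: "1 < real k * (norm ?w - 1/4 * norm (v n))"
      using reals_Archimedean3[OF pos] by blast
    \<comment> \<open>Indices advance in steps of \<open>p\<close>, so that consecutive increments
      telescope.\<close>
    have "(\<Sum>i<k. v (n + (J + i * p))) = (F ^^ (n + J + k * p)) x - (F ^^ (n + J)) x"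
      using sum_lessThan_telescope[of "\<lambda>i. (F ^^ (n + J + i * p)) x" k]
      by (simp add: v_def add_ac)
    then have sum: "norm (\<Sum>i<k. v (n + (J + i * p))) < 1"
      using norm_triangle_ineq4[of "(F ^^ (n + J + k * p)) x" "(F ^^ (n + J)) x"]
        orbit[of "n + J + k * p"] orbit[of "n + J"] by simp
    have "norm (\<Sum>i<k. v (n + (J + i * p)) - ?w) \<le> real k * (1/4 * norm (v n))"
      using sum_norm_le[of "{..<k}" "\<lambda>i. v (n + (J + i * p)) - ?w" "\<lambda>_. 1/4 * norm (v n)"] close
      by simp
    moreover have "(\<Sum>i<k. v (n + (J + i * p)) - ?w) = (\<Sum>i<k. v (n + (J + i * p))) - real k *\<^sub>R ?w"
      by (simp add: sum_subtractf sum_constant_scaleR)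
    ultimately have "real k * norm ?w \<le> 1 + real k * (1/4 * norm (v n))"
      using sum norm_triangle_ineq3[of "real k *\<^sub>R ?w" "\<Sum>i<k. v (n + (J + i * p))"]
      by (simp add: norm_minus_commute)
    then show False using k by (simp add: algebra_simps)
  qed
  then show ?thesis
    using close[OF j] norm_triangle_ineq[of "v (n + j) - ?w" ?w] by (simp add: v_def)
qed

text \<open>Every block of \<open>J\<close> iterations at least halves the increment over
  \<open>p\<close> steps, at a rate that depends neither on \<open>p\<close> nor on
  \<open>x\<close>.\<close>

lemma uniformly_Cauchy_near_zero:
  assumes Cau: "\<And>e. e > 0 \<Longrightarrow> \<exists>N. \<forall>m\<ge>N. \<forall>n\<ge>N. \<forall>x. norm ((A ^^ m) x - (A ^^ n) x) \<le> e * norm x"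
    and "e > 0"
  shows "\<exists>N. \<forall>n\<ge>N. \<forall>p x. norm x < 1/64 \<longrightarrow> norm ((F ^^ (n + p)) x - (F ^^ n) x) \<le> e"
proof -
  obtain J where J: "\<And>j x. j \<ge> J \<Longrightarrow> norm ((A ^^ j) x - (A ^^ J) x) \<le> 1/8 * norm x"
    using Cau[of "1/8"] by auto
  have decay: "norm ((F ^^ (n + p)) x - (F ^^ n) x) \<le> (1/2) ^ k" if "n \<ge> k * J" "norm x < 1/64" for k n p x
    using that(1)
  proof (induction k arbitrary: n)
    case 0
    then show ?case
      using norm_triangle_ineq4[of "(F ^^ (n + p)) x" "(F ^^ n) x"] that(2)
        norm_funpow_le[of x n] norm_funpow_le[of x "n + p"] by simp
  next
    case (Suc k)
    define n' where "n' = n - J"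
    have n': "n = n' + J" "n' \<ge> k * J" using Suc.prems by (auto simp: n'_def)
    show ?case
      using increment_halves[OF J that(2) order_refl, of n' p] Suc.IH[OF n'(2)] by (simp add: n'(1))
  qed
  obtain k where "(1/2) ^ k < e" using real_arch_pow_inv[OF \<open>e > 0\<close>, of "1/2"] by auto
  then show ?thesis
    by (intro exI[of _ "k * J"]) (meson decay less_imp_le order_trans)
qed

text \<open>The Cauchy property on the ball of radius 1/64 spreads to radius \<open>r\<close> by
  \<open>norm_le_of_small_near_zero\<close>: \<open>K\<close> is fixed to make the Taylor tail
  small, then \<open>N\<close> for closeness \<open>e / (4 * S)\<close> near 0.\<close>

theorem funpow_converges_inside_ball:
  assumes Cau: "\<And>e. e > 0 \<Longrightarrow> \<exists>N. \<forall>m\<ge>N. \<forall>n\<ge>N. \<forall>x. norm ((A ^^ m) x - (A ^^ n) x) \<le> e * norm x"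
  shows "\<exists>\<phi>. converges_inside_ball (\<lambda>n. F ^^ n) \<phi>"
proof -
  have "uniformly_Cauchy_on (cball 0 r) (\<lambda>n. F ^^ n)" if r: "0 \<le> r" "r < 1" for r
  proof (rule uniformly_Cauchy_onI')
    fix e :: real assume "e > 0"
    have "(\<lambda>K. 2 * r ^ K / (1 - r)) \<longlonglongrightarrow> 2 * 0 / (1 - r)"
      using r by (intro tendsto_intros LIMSEQ_realpow_zero) auto
    then have "\<forall>\<^sub>F K in sequentially. 2 * r ^ K / (1 - r) < e / 2"
      using \<open>e > 0\<close> by (intro order_tendstoD(2)) auto
    then obtain K where K: "2 * r ^ K / (1 - r) < e / 2"
      by (auto simp: eventually_sequentially)
    \<comment> \<open>The added 1 keeps \<open>S\<close> positive even for
      \<open>K = 0\<close>.\<close>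
    define S where "S = (\<Sum>k<K. (r / (1/64)) ^ k) + 1"
    have S: "S > 0" using r by (auto simp: S_def intro!: add_nonneg_pos sum_nonneg)
    have "e / (4 * S) > 0" using S \<open>e > 0\<close> by simp
    from uniformly_Cauchy_near_zero[OF Cau this] obtain N where
      N: "\<And>n p x. n \<ge> N \<Longrightarrow> norm x < 1/64 \<Longrightarrow> norm ((F ^^ (n + p)) x - (F ^^ n) x) \<le> e / (4 * S)"
      by blast
    have "dist ((F ^^ m) x) ((F ^^ n) x) < e" if "x \<in> cball 0 r" "m \<ge> N" "n > m" for x m n
    proof -
      obtain p where p: "n = m + p" using \<open>n > m\<close> less_imp_add_positive by blast
      have x: "norm x \<le> r" using that by simp
      have "norm ((F ^^ (m + p)) x - (F ^^ m) x)
          \<le> e / (4 * S) * (\<Sum>k<K. (norm x / (1/64)) ^ k) + 2 * norm x ^ K / (1 - norm x)"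
        by (rule norm_le_of_small_near_zero[OF Hol_funpow_diff]) (use N \<open>m \<ge> N\<close> x r in auto)
      also have "\<dots> \<le> e / (4 * S) * S + 2 * r ^ K / (1 - r)"
      proof (rule add_mono)
        have "(\<Sum>k<K. (norm x / (1/64)) ^ k) \<le> (\<Sum>k<K. (r / (1/64)) ^ k)"
          using x by (intro sum_mono power_mono divide_right_mono) auto
        then show "e / (4 * S) * (\<Sum>k<K. (norm x / (1/64)) ^ k) \<le> e / (4 * S) * S"
          using S \<open>e > 0\<close> by (intro mult_left_mono) (auto simp: S_def)
        show "2 * norm x ^ K / (1 - norm x) \<le> 2 * r ^ K / (1 - r)"
          using x r by (intro frac_le mult_left_mono power_mono) auto
      qed
      also have "\<dots> = e / 4 + 2 * r ^ K / (1 - r)" using S by simp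
      also have "\<dots> < e" using K \<open>e > 0\<close> by linarith
      finally show ?thesis by (simp add: p dist_norm norm_minus_commute)
    qed
    then show "\<exists>M. \<forall>x\<in>cball 0 r. \<forall>m\<ge>M. \<forall>n>m. dist ((F ^^ m) x) ((F ^^ n) x) < e"
      by blast
  qed
  then have lim: "uniform_limit (cball 0 r) (\<lambda>n. F ^^ n) (\<lambda>x. lim (\<lambda>n. (F ^^ n) x)) sequentially"
    if "0 \<le> r" "r < 1" for r
    using that Cauchy_uniformly_convergent uniformly_convergent_uniform_limit_iff by metis
  \<comment> \<open>A negative \<open>r\<close> leaves only the empty set, which
    \<open>max r 0\<close> covers too.\<close>
  have "uniform_limit K (\<lambda>n. F ^^ n) (\<lambda>x. lim (\<lambda>n. (F ^^ n) x)) sequentially"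
    if "r < 1" "K \<subseteq> cball 0 r" for r K
    by (rule uniform_limit_on_subset[OF lim[of "max r 0"]]) (use that in \<open>auto simp: subset_iff le_max_iff_disj\<close>)
  then show ?thesis
    unfolding converges_inside_ball_def by blast
qed

section \<open>The limit of the iterates\<close>

lemma tendsto_of_converges_inside_ball:
  assumes "converges_inside_ball (\<lambda>n. F ^^ n) \<phi>" "norm x < 1"
  shows "(\<lambda>n. (F ^^ n) x) \<longlonglongrightarrow> \<phi> x"
  by (rule tendsto_uniform_limitI[OF converges_inside_ballD[OF assms]]) simp

lemma uniform_Cauchy_of_converges_inside_ball:
  assumes "converges_inside_ball (\<lambda>n. F ^^ n) \<phi>" "r < 1" "e > 0"
  obtains N where "\<And>m n x. m \<ge> N \<Longrightarrow> n \<ge> N \<Longrightarrow> norm x \<le> r \<Longrightarrow> norm ((F ^^ m) x - (F ^^ n) x) < e"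
proof -
  have "uniformly_Cauchy_on (cball 0 r) (\<lambda>n. F ^^ n)"
    using converges_inside_ballD[OF assms(1,2)]
    by (intro uniformly_convergent_Cauchy) (auto simp: uniformly_convergent_on_def)
  then obtain N where
    "\<And>m n x. m \<ge> N \<Longrightarrow> n \<ge> N \<Longrightarrow> x \<in> cball 0 r \<Longrightarrow> dist ((F ^^ m) x) ((F ^^ n) x) < e"
    using \<open>e > 0\<close> unfolding uniformly_Cauchy_on_def by blast
  then show ?thesis using that[of N] by (simp add: dist_norm)
qed

text \<open>A difference of iterates bounded by \<open>e / 2\<close> on the ball of radius 1/2 has a
  derivative at 0 of norm at most \<open>e\<close>.\<close>

lemma Cauchy_powers_of_converges_inside_ball:
  assumes conv: "converges_inside_ball (\<lambda>n. F ^^ n) \<phi>" and "e > 0"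
  shows "\<exists>N. \<forall>m\<ge>N. \<forall>n\<ge>N. \<forall>x. norm ((A ^^ m) x - (A ^^ n) x) \<le> e * norm x"
proof -
  obtain N where N: "\<And>m n x. m \<ge> N \<Longrightarrow> n \<ge> N \<Longrightarrow> norm x \<le> 1/2 \<Longrightarrow>
      norm ((F ^^ m) x - (F ^^ n) x) < e / 2"
    using uniform_Cauchy_of_converges_inside_ball[OF conv, of "1/2" "e / 2"] \<open>e > 0\<close> by auto
  have "norm ((A ^^ m) x - (A ^^ n) x) \<le> e * norm x" if "m \<ge> N" "n \<ge> N" for m n x
  proof -
    have half: "F ^^ k \<in> Hol (ball 0 (1/2)) UNIV" for k
      by (rule Hol_mono[OF funpow_Hol]) auto
    have "norm ((F ^^ m) x - (F ^^ n) x) \<le> e / 2" if "x \<in> ball 0 (1/2)" for x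
      using N[OF \<open>m \<ge> N\<close> \<open>n \<ge> N\<close>, of x] that by simp
    then have "(\<lambda>x. (F ^^ m) x - (F ^^ n) x) \<in> Hol (ball 0 (1/2)) (cball 0 (e / 2))"
      by (intro Hol_diff[OF half half]) simp
    from Cauchy_estimate_derivative[OF this _ has_derivative_diff[OF funpow_has_derivative funpow_has_derivative]
        bounded_clinear_diff[OF bounded_clinear_funpow bounded_clinear_funpow]]
    show ?thesis using A(2) by simp
  qed
  then show ?thesis by blast
qed

text \<open>A Weierstrass argument: Cauchy estimates for differences of iterates make the
  derivatives at \<open>x\<close> converge, and the quadratic remainder bound, uniform in
  \<open>n\<close>, passes to the limit.\<close>

lemma limit_has_derivative:
  assumes conv: "converges_inside_ball (\<lambda>n. F ^^ n) \<phi>" and x: "norm x < 1"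
  shows "\<exists>D. (\<phi> has_derivative D) (at x) \<and> bounded_clinear D"
proof -
  define r where "r = (1 - norm x) / 2"
  have r: "r > 0" using x by (simp add: r_def)
  have in_ball: "norm y < 1 - r" if "y \<in> ball x r" for y
    using that norm_triangle_ineq[of x "y - x"] by (simp add: r_def dist_norm norm_minus_commute field_simps)
  then have sub: "ball x r \<subseteq> unit_ball" using r by fastforce
  have Hol1: "F ^^ n \<in> Hol (ball x r) (cball 0 1)" for n
    by (rule Hol_mono[OF funpow_Hol sub]) auto
  have "\<exists>D. (F ^^ n has_derivative D) (at x) \<and> bounded_clinear D" for n
    using HolD[OF Hol1, of x n] r by (metis centre_in_ball)
  then obtain D where D: "\<And>n. (F ^^ n has_derivative D n) (at x)" "\<And>n. bounded_clinear (D n)"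
    by metis
  have "Cauchy (\<lambda>n. D n v)" for v
  proof (rule CauchyI)
    fix e :: real assume "e > 0"
    \<comment> \<open>The estimate \<open>d / r * norm v\<close> must stay below \<open>e\<close>;
      the added 1 allows \<open>v = 0\<close>.\<close>
    define d where "d = e * r / (norm v + 1)"
    have d: "d > 0" using \<open>e > 0\<close> r by (simp add: d_def add_nonneg_pos)
    obtain N where N: "\<And>m n y. m \<ge> N \<Longrightarrow> n \<ge> N \<Longrightarrow> norm y \<le> 1 - r \<Longrightarrow>
        norm ((F ^^ m) y - (F ^^ n) y) < d"
      using uniform_Cauchy_of_converges_inside_ball[OF conv, of "1 - r" d] r d by auto
    have "norm (D m v - D n v) < e" if "m \<ge> N" "n \<ge> N" for m n
    proof -
      have "norm ((F ^^ m) y - (F ^^ n) y) \<le> d" if "y \<in> ball x r" for y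
        using N[OF \<open>m \<ge> N\<close> \<open>n \<ge> N\<close>, of y] in_ball[OF that] by simp
      then have "(\<lambda>x. (F ^^ m) x - (F ^^ n) x) \<in> Hol (ball x r) (cball 0 d)"
        by (intro Hol_diff[OF Hol1 Hol1]) simp
      from Cauchy_estimate_derivative[OF this r has_derivative_diff[OF D(1) D(1)]
          bounded_clinear_diff[OF D(2) D(2)]]
      have "norm (D m v - D n v) \<le> d / r * norm v" .
      also have "\<dots> = e * (norm v / (norm v + 1))" using r by (simp add: d_def)
      also have "\<dots> < e * 1"
        using \<open>e > 0\<close> by (intro mult_strict_left_mono) (auto simp: divide_less_eq add_nonneg_pos)
      finally show ?thesis by simp
    qed
    then show "\<exists>N. \<forall>m\<ge>N. \<forall>n\<ge>N. norm (D m v - D n v) < e" by blast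
  qed
  then have "\<exists>l. (\<lambda>n. D n v) \<longlonglongrightarrow> l" for v
    using Cauchy_convergent convergent_def by blast
  then obtain E where E: "\<And>v. (\<lambda>n. D n v) \<longlonglongrightarrow> E v" by metis
  note linD = bounded_clinear_linear[OF D(2)]
  have E_scaleC: "E (c *\<^sub>C v) = c *\<^sub>C E v" for c v
  proof (rule LIMSEQ_unique[OF E])
    show "(\<lambda>n. D n (c *\<^sub>C v)) \<longlonglongrightarrow> c *\<^sub>C E v"
      unfolding bounded_clinear_scaleC[OF D(2)]
      by (rule bounded_linear.tendsto[OF scaleC.bounded_linear_right E])
  qed
  have "bounded_linear E"
  proof (rule bounded_linear_intro[where K = "1 / r"])
    show "E (v + w) = E v + E w" for v w
      by (rule LIMSEQ_unique[OF E]) (simp add: linear_add[OF linD] tendsto_add E)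
    show "E (s *\<^sub>R v) = s *\<^sub>R E v" for s v
      by (simp add: scaleR_scaleC E_scaleC)
    show "norm (E v) \<le> norm v * (1 / r)" for v
    proof (rule tendsto_upperbound[OF tendsto_norm[OF E]])
      show "\<forall>\<^sub>F n in sequentially. norm (D n v) \<le> norm v * (1 / r)"
        using Cauchy_estimate_derivative[OF Hol1 r D, of _ v] by (simp add: field_simps)
    qed simp
  qed
  then have "bounded_clinear E" using E_scaleC by (simp add: bounded_clinear_def)
  moreover have "(\<phi> has_derivative E) (at x)"
    unfolding has_derivative_at_alt
  proof (intro conjI allI impI \<open>bounded_linear E\<close>)
    fix e :: real assume "e > 0"
    \<comment> \<open>\<open>r / 2\<close> is the range of the remainder estimate, and
      \<open>e * r\<^sup>2 / 2\<close> turns its quadratic bound into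
      \<open>e * norm (y - x)\<close>.\<close>
    define d where "d = min (r / 2) (e * r\<^sup>2 / 2)"
    have "norm (\<phi> y - \<phi> x - E (y - x)) \<le> e * norm (y - x)" if "norm (y - x) < d" for y
    proof -
      have y: "norm y < 1"
        using in_ball[of y] that r by (simp add: d_def dist_norm norm_minus_commute)
      have "norm (\<phi> y - \<phi> x - E (y - x)) \<le> 2 * 1 / r\<^sup>2 * (norm (y - x))\<^sup>2"
      proof (rule tendsto_upperbound)
        show "(\<lambda>n. norm ((F ^^ n) y - (F ^^ n) x - D n (y - x))) \<longlonglongrightarrow> norm (\<phi> y - \<phi> x - E (y - x))"
          by (intro tendsto_intros tendsto_of_converges_inside_ball[OF conv] x y E)
        show "\<forall>\<^sub>F n in sequentially. norm ((F ^^ n) y - (F ^^ n) x - D n (y - x))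
            \<le> 2 * 1 / r\<^sup>2 * (norm (y - x))\<^sup>2"
          using Cauchy_estimate_remainder[OF Hol1 r D, of "y - x"] that by (simp add: d_def)
      qed simp
      also have "\<dots> = (2 / r\<^sup>2 * norm (y - x)) * norm (y - x)" by (simp add: power2_eq_square)
      also have "\<dots> \<le> e * norm (y - x)"
        using that r by (intro mult_right_mono) (auto simp: d_def field_simps)
      finally show ?thesis .
    qed
    moreover have "d > 0" using r \<open>e > 0\<close> by (simp add: d_def)
    ultimately show "\<exists>d>0. \<forall>y. norm (y - x) < d \<longrightarrow> norm (\<phi> y - \<phi> x - E (y - x)) \<le> e * norm (y - x)"
      by blast
  qed
  ultimately show ?thesis by blast
qed

text \<open>Orbits do not increase the norm, so limits stay in the open ball, where continuity of
  \<open>F\<close> makes them fixed points; conversely a fixed point is its own orbit limit.\<close>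

theorem limit_holomorphic_retraction:
  assumes conv: "converges_inside_ball (\<lambda>n. F ^^ n) \<phi>"
  shows "holomorphic_retraction \<phi> {x \<in> unit_ball. F x = x}"
proof -
  note lim = tendsto_of_converges_inside_ball[OF conv]
  have norm_le: "norm (\<phi> x) \<le> norm x" if "norm x < 1" for x
    by (rule tendsto_upperbound[OF tendsto_norm[OF lim[OF that]]]) (simp_all add: norm_funpow_le that)
  have fixed: "F (\<phi> x) = \<phi> x" if x: "norm x < 1" for x
  proof -
    have "\<phi> x \<in> unit_ball" using norm_le[OF x] x by simp
    then have "isCont F (\<phi> x)"
      using HolD[OF F] has_derivative_continuous by blast
    then have "(\<lambda>n. F ((F ^^ n) x)) \<longlonglongrightarrow> F (\<phi> x)"
      by (rule isCont_tendsto_compose[OF _ lim[OF x]])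
    moreover have "(\<lambda>n. F ((F ^^ n) x)) \<longlonglongrightarrow> \<phi> x"
      using LIMSEQ_Suc[OF lim[OF x]] by simp
    ultimately show ?thesis by (rule LIMSEQ_unique)
  qed
  have id: "\<phi> z = z" if "norm z < 1" "F z = z" for z
  proof -
    have "(F ^^ n) z = z" for n by (induction n) (simp_all add: that)
    then show ?thesis using LIMSEQ_unique[OF lim[OF that(1)]] by simp
  qed
  have "\<phi> ` unit_ball \<subseteq> {x \<in> unit_ball. F x = x}"
    using norm_le fixed by (fastforce intro: le_less_trans)
  moreover have "{x \<in> unit_ball. F x = x} \<subseteq> \<phi> ` unit_ball"
    using id by force
  moreover have "\<phi> \<in> Hol unit_ball unit_ball"
    using calculation(1) limit_has_derivative[OF conv] by (auto simp: Hol_def)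
  ultimately show ?thesis
    unfolding holomorphic_retraction_def using id by auto
qed

end


section \<open>The Abel average\<close>

lemma bij_scaleC: "b \<noteq> 0 \<Longrightarrow> bij (\<lambda>x::'a::complex_banach. b *\<^sub>C x)"
  by (rule o_bij[of "\<lambda>x. inverse b *\<^sub>C x"]) (auto simp: fun_eq_iff scaleC_scaleC)

text \<open>Distances from \<open>1 / \<alpha>\<close> are multiplied by the absolute value of
  \<alpha>. With \<open>\<mu> = (1 - \<alpha> * \<omega>) / (1 - \<alpha> * \<zeta>)\<close> the
  resulting inequality says that \<mu> lies in the open unit disc.\<close>

lemma Omega_iff:
  fixes \<alpha> \<omega> :: real
  assumes "\<alpha> \<noteq> 0"
  shows "\<zeta> \<in> Omega \<alpha> \<omega> \<longleftrightarrow> \<zeta> = of_real \<omega> \<or> cmod (of_real (1 - \<alpha> * \<omega>)) < cmod (1 - of_real \<alpha> * \<zeta>)"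
proof -
  have "cmod (1 - of_real \<alpha> * \<xi>) = \<bar>\<alpha>\<bar> * cmod (\<xi> - 1 / of_real \<alpha>)" for \<xi>
  proof -
    have "1 - of_real \<alpha> * \<xi> = - (of_real \<alpha> * (\<xi> - 1 / of_real \<alpha>))"
      using assms by (simp add: right_diff_distrib)
    then show ?thesis by (simp add: norm_mult)
  qed
  moreover from this[of "of_real \<omega>"]
  have "cmod (of_real (1 - \<alpha> * \<omega>)) = \<bar>\<alpha>\<bar> * cmod (of_real \<omega> - 1 / of_real \<alpha>)" by simp
  ultimately show ?thesis
    using assms by (simp add: Omega_def del: of_real_diff)
qed

context
  fixes h :: "'a::complex_banach \<Rightarrow> 'a" and \<alpha> \<omega> :: real
  assumes h: "h \<in> Hol unit_ball UNIV" "h 0 = 0"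
    and \<alpha>: "\<alpha> \<noteq> 0" "\<alpha> * \<omega> \<noteq> 1"
    and def: "abel_average_defined h \<alpha> \<omega>"
    and hol: "abel_average h \<alpha> \<omega> \<in> Hol unit_ball unit_ball"
begin

private abbreviation (input) "F \<equiv> abel_average h \<alpha> \<omega>"
private abbreviation (input) "T \<equiv> frechet_derivative h (at 0)"
private abbreviation (input) "c \<equiv> 1 - \<alpha> * \<omega>"
private abbreviation (input) "G \<equiv> \<lambda>y. inverse c *\<^sub>R (y - \<alpha> *\<^sub>R h y)"

private lemma c_nonzero: "c \<noteq> 0"
  using \<alpha> by simp

lemma abel_average_solves:
  assumes "norm x < 1"
  shows "norm (F x) < 1" "F x - \<alpha> *\<^sub>R h (F x) = c *\<^sub>R x"
proof -
  have "\<exists>!y. y \<in> unit_ball \<and> y - \<alpha> *\<^sub>R h y = c *\<^sub>R x"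
    using def assms by (simp add: abel_average_defined_def)
  from theI'[OF this] show "norm (F x) < 1" "F x - \<alpha> *\<^sub>R h (F x) = c *\<^sub>R x"
    by (simp_all add: abel_average_def)
qed

lemma abel_average_eqI:
  assumes "norm x < 1" "norm y < 1" "y - \<alpha> *\<^sub>R h y = c *\<^sub>R x"
  shows "F x = y"
proof -
  have "\<exists>!y. y \<in> unit_ball \<and> y - \<alpha> *\<^sub>R h y = c *\<^sub>R x"
    using def assms by (simp add: abel_average_defined_def)
  then show ?thesis
    unfolding abel_average_def using assms by (intro the1_equality) auto
qed

lemma abel_average_zero: "F 0 = 0"
  by (rule abel_average_eqI) (simp_all add: h(2))

lemma abel_average_fixed_points: "{x \<in> unit_ball. F x = x} = Null h \<omega>"
proof -
  have "F x = x \<longleftrightarrow> h x = \<omega> *\<^sub>R x" if x: "norm x < 1" for x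
  proof -
    have "F x = x \<longleftrightarrow> x - \<alpha> *\<^sub>R h x = c *\<^sub>R x"
      using abel_average_solves(2)[OF x] abel_average_eqI[OF x x] by metis
    also have "\<dots> \<longleftrightarrow> \<alpha> *\<^sub>R h x = \<alpha> *\<^sub>R \<omega> *\<^sub>R x"
      by (auto simp: scaleR_diff_left)
    also have "\<dots> \<longleftrightarrow> h x = \<omega> *\<^sub>R x" using \<alpha>(1) by (simp del: scaleR_scaleR)
    finally show ?thesis .
  qed
  then show ?thesis by (auto simp: Null_def)
qed

private lemma T: "(h has_derivative T) (at 0)" "bounded_clinear T"
proof -
  obtain T' where "(h has_derivative T') (at 0)" "bounded_clinear T'"
    using HolD[OF h(1), of 0] by auto
  moreover from this have "T' = T" by (intro frechet_derivative_at)
  ultimately show "(h has_derivative T) (at 0)" "bounded_clinear T" by simp_all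
qed

private abbreviation (input) "G' \<equiv> \<lambda>v. inverse c *\<^sub>R (v - \<alpha> *\<^sub>R T v)"

text \<open>\<open>G\<close> is a local inverse of the Abel average at 0 on both sides, by uniqueness of the solution in the ball; hence the
  derivative there is invertible.\<close>

lemma abel_average_derivative:
  obtains A where "(F has_derivative A) (at 0)" "bounded_clinear A"
    "\<And>v. A (G' v) = v" "\<And>v. G' (A v) = v"
proof -
  obtain A where A: "(F has_derivative A) (at 0)" "bounded_clinear A"
    using HolD[OF hol, of 0] by auto
  have G: "(G has_derivative G') (at 0)"
    by (intro derivative_intros T(1))
  have G0: "G 0 = 0" by (simp add: h(2))
  have id: "((\<lambda>x. x) has_derivative (\<lambda>x. x)) (at (0::'a))" by (rule has_derivative_ident)
  have "(G \<circ> F has_derivative G' \<circ> A) (at 0)"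
    by (rule diff_chain_at[OF A(1)]) (simp add: abel_average_zero G)
  moreover have "(G \<circ> F has_derivative (\<lambda>x. x)) (at 0)"
    by (rule has_derivative_transform_within_open[OF id open_ball[of 0 1]])
      (use c_nonzero abel_average_solves(2) in auto)
  ultimately have GA: "G' \<circ> A = (\<lambda>x. x)" by (rule has_derivative_unique)
  have "(F \<circ> G has_derivative A \<circ> G') (at 0)"
    by (rule diff_chain_at[OF G]) (simp only: G0 A(1))
  moreover have "(F \<circ> G has_derivative (\<lambda>x. x)) (at 0)"
  proof (rule has_derivative_transform_eventually[OF id])
    have "isCont G 0" using G by (rule has_derivative_continuous)
    then have "(G \<longlongrightarrow> 0) (at 0)" by (simp only: isCont_def G0)
    then have "\<forall>\<^sub>F y in at 0. dist (G y) 0 < 1" by (rule tendstoD) simp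
    moreover have "\<forall>\<^sub>F y::'a in at 0. dist y 0 < 1"
      by (rule tendstoD[OF tendsto_ident_at]) simp
    ultimately show "\<forall>\<^sub>F y in at 0. y = (F \<circ> G) y"
    proof eventually_elim
      case (elim y)
      then have "norm (G y) < 1" "norm y < 1" by (simp_all only: dist_norm diff_zero)
      moreover have "y - \<alpha> *\<^sub>R h y = c *\<^sub>R G y" using c_nonzero by simp
      ultimately show ?case using abel_average_eqI[of "G y" y] by (simp only: o_apply)
    qed
    show "(0::'a) = (F \<circ> G) 0" by (simp only: o_apply G0 abel_average_zero)
  qed simp
  ultimately have AG: "A \<circ> G' = (\<lambda>x. x)" by (rule has_derivative_unique)
  show ?thesis
    using that[OF A] fun_cong[OF AG] fun_cong[OF GA] by simp
qed

section \<open>Spectral correspondence between the derivatives at 0 of the Abel average and of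
  \<open>h\<close>\<close>

context
  fixes A
  assumes A: "(F has_derivative A) (at 0)" "bounded_clinear A"
    and AG: "\<And>v. A (G' v) = v" and GA: "\<And>v. G' (A v) = v"
begin

private lemma linear_T: "linear T"
  using T(2) by (rule bounded_clinear_linear)

text \<open>\<open>G' - I\<close> is a nonzero multiple of \<open>\<omega> I - T\<close>, and
  \<open>I - A\<close> is \<open>G' - I\<close> composed with the bijection
  \<open>A\<close>.\<close>

lemma range_diff_A_eq: "range (\<lambda>x. x - A x) = range (\<lambda>x. \<omega> *\<^sub>R x - T x)"
proof -
  have diff: "G' u - u = (\<alpha> / c) *\<^sub>R (\<omega> *\<^sub>R u - T u)" for u
  proof -
    have "c *\<^sub>R (G' u - u) = u - \<alpha> *\<^sub>R T u - c *\<^sub>R u"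
      using c_nonzero by (simp add: scaleR_diff_right)
    also have "\<dots> = \<alpha> *\<^sub>R (\<omega> *\<^sub>R u - T u)"
      by (simp add: scaleR_diff_left scaleR_diff_right)
    finally have "inverse c *\<^sub>R c *\<^sub>R (G' u - u) = inverse c *\<^sub>R \<alpha> *\<^sub>R (\<omega> *\<^sub>R u - T u)"
      by (simp only:)
    then show ?thesis using c_nonzero by (simp add: divide_inverse mult.commute)
  qed
  have scale: "r *\<^sub>R (\<omega> *\<^sub>R u - T u) = \<omega> *\<^sub>R (r *\<^sub>R u) - T (r *\<^sub>R u)" for r u
    by (simp add: linear_cmul[OF linear_T] scaleR_diff_right mult.commute)
  have "x - A x = \<omega> *\<^sub>R ((\<alpha> / c) *\<^sub>R A x) - T ((\<alpha> / c) *\<^sub>R A x)" for x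
  proof -
    have "x - A x = G' (A x) - A x" by (simp only: GA)
    also have "\<dots> = (\<alpha> / c) *\<^sub>R (\<omega> *\<^sub>R A x - T (A x))" by (rule diff)
    finally show ?thesis by (simp only: scale)
  qed
  moreover have "\<omega> *\<^sub>R w - T w = G' ((c / \<alpha>) *\<^sub>R w) - A (G' ((c / \<alpha>) *\<^sub>R w))" for w
  proof -
    have "G' ((c / \<alpha>) *\<^sub>R w) - A (G' ((c / \<alpha>) *\<^sub>R w)) = G' ((c / \<alpha>) *\<^sub>R w) - (c / \<alpha>) *\<^sub>R w"
      by (simp only: AG)
    also have "\<dots> = (\<alpha> / c) *\<^sub>R (\<omega> *\<^sub>R (c / \<alpha>) *\<^sub>R w - T ((c / \<alpha>) *\<^sub>R w))"
      by (rule diff)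
    also have "\<dots> = \<omega> *\<^sub>R (\<alpha> / c) *\<^sub>R (c / \<alpha>) *\<^sub>R w - T ((\<alpha> / c) *\<^sub>R (c / \<alpha>) *\<^sub>R w)"
      by (rule scale)
    also have "(\<alpha> / c) *\<^sub>R (c / \<alpha>) *\<^sub>R w = w" using \<alpha>(1) c_nonzero by simp
    finally show ?thesis by simp
  qed
  ultimately show ?thesis by (metis (no_types, lifting) image_subset_iff range_eqI subset_antisym)
qed

lemma kernel_diff_A_eq: "kernel (\<lambda>x. x - A x) = kernel (\<lambda>x. \<omega> *\<^sub>R x - T x)"
proof -
  have "x - A x = 0 \<longleftrightarrow> \<omega> *\<^sub>R x - T x = 0" for x
  proof -
    have "x - A x = 0 \<longleftrightarrow> G' x = x"
      using AG[of x] GA[of x] by (metis eq_iff_diff_eq_0)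
    also have "\<dots> \<longleftrightarrow> c *\<^sub>R G' x = c *\<^sub>R x" using c_nonzero by (simp del: scaleR_scaleR)
    also have "\<dots> \<longleftrightarrow> x - \<alpha> *\<^sub>R T x = c *\<^sub>R x" using c_nonzero by simp
    also have "\<dots> \<longleftrightarrow> \<alpha> *\<^sub>R \<omega> *\<^sub>R x = \<alpha> *\<^sub>R T x" by (auto simp: scaleR_diff_left)
    also have "\<dots> \<longleftrightarrow> \<omega> *\<^sub>R x - T x = 0" using \<alpha>(1) by (simp del: scaleR_scaleR)
    finally show ?thesis .
  qed
  then show ?thesis by (simp add: kernel_def)
qed

private lemma bij_A: "bij A" and bij_G': "bij G'"
  by (rule o_bij[of G'], simp_all only: fun_eq_iff o_apply AG GA id_apply simp_thms)
    (rule o_bij[of A], simp_all only: fun_eq_iff o_apply AG GA id_apply simp_thms)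

text \<open>The relation means \<open>\<mu> = c / (1 - \<alpha> * \<zeta>)\<close>. Composing
  \<open>\<mu> - A\<close> with the bijection \<open>G'\<close> yields \<open>\<mu> G' - I\<close>,
  a nonzero multiple of \<open>\<zeta> - T\<close>.\<close>

lemma bij_diff_A_iff:
  assumes \<mu>: "\<mu> \<noteq> 0" and \<zeta>: "of_real \<alpha> * \<zeta> = 1 - of_real c / \<mu>"
  shows "bij (\<lambda>x. \<mu> *\<^sub>C x - A x) \<longleftrightarrow> bij (\<lambda>x. \<zeta> *\<^sub>C x - T x)"
proof -
  define b where "b = \<mu> * of_real (\<alpha> / c)"
  have b: "b \<noteq> 0" using \<mu> \<alpha>(1) c_nonzero by (simp add: b_def del: of_real_diff)
  have eq: "\<mu> *\<^sub>C G' x - x = b *\<^sub>C (\<zeta> *\<^sub>C x - T x)" for x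
  proof -
    have "\<mu> *\<^sub>C G' x - x = (\<mu> * of_real (inverse c) - 1) *\<^sub>C x - (\<mu> * of_real (inverse c) * of_real \<alpha>) *\<^sub>C T x"
      by (simp only: scaleR_scaleC scaleC_scaleC scaleC.diff_right scaleC.diff_left scaleC_one mult.assoc
          diff_diff_eq add.commute)
    also have "\<mu> * of_real (inverse c) * of_real \<alpha> = b"
      by (simp add: b_def divide_inverse del: of_real_diff)
    also have "\<mu> * of_real (inverse c) - 1 = b * \<zeta>"
    proof -
      have "b * \<zeta> = \<mu> * of_real (inverse c) * (of_real \<alpha> * \<zeta>)"
        by (simp add: b_def divide_inverse del: of_real_diff)
      also have "\<dots> = \<mu> * of_real (inverse c) - 1"
        unfolding \<zeta> using \<mu> c_nonzero by (simp add: field_simps del: of_real_diff)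
      finally show ?thesis by simp
    qed
    finally show ?thesis by (simp add: scaleC.diff_right scaleC_scaleC)
  qed
  show ?thesis
  proof
    assume "bij (\<lambda>x. \<mu> *\<^sub>C x - A x)"
    then have "bij ((\<lambda>x. inverse b *\<^sub>C x) \<circ> ((\<lambda>x. \<mu> *\<^sub>C x - A x) \<circ> G'))"
      using b by (intro bij_comp bij_A bij_G' bij_scaleC) auto
    moreover have "(\<lambda>x. inverse b *\<^sub>C x) \<circ> ((\<lambda>x. \<mu> *\<^sub>C x - A x) \<circ> G') = (\<lambda>x. \<zeta> *\<^sub>C x - T x)"
      unfolding fun_eq_iff o_apply AG eq using b by (simp add: scaleC_scaleC)
    ultimately show "bij (\<lambda>x. \<zeta> *\<^sub>C x - T x)" by simp
  next
    assume "bij (\<lambda>x. \<zeta> *\<^sub>C x - T x)"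
    then have "bij ((\<lambda>x. b *\<^sub>C x) \<circ> ((\<lambda>x. \<zeta> *\<^sub>C x - T x) \<circ> A))"
      using b by (intro bij_comp bij_A bij_G' bij_scaleC) auto
    moreover have "(\<lambda>x. b *\<^sub>C x) \<circ> ((\<lambda>x. \<zeta> *\<^sub>C x - T x) \<circ> A) = (\<lambda>x. \<mu> *\<^sub>C x - A x)"
      unfolding fun_eq_iff o_apply eq[symmetric] GA by simp
    ultimately show "bij (\<lambda>x. \<mu> *\<^sub>C x - A x)" by simp
  qed
qed

text \<open>Under the substitution of \<open>bij_diff_A_iff\<close>, a point outside
  \<open>Omega \<alpha> \<omega>\<close> other than \<open>1 / \<alpha>\<close> becomes some
  \<open>\<mu> \<noteq> 1\<close> of modulus at least 1. Conversely a unimodular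
  \<open>\<mu> \<noteq> 1\<close> comes from a point where the inequality defining
  \<open>Omega \<alpha> \<omega>\<close> is an equality.\<close>

theorem Cauchy_powers_iff_spectrum:
  assumes sum: "is_direct_sum (kernel (\<lambda>x. \<omega> *\<^sub>R x - T x)) (range (\<lambda>x. \<omega> *\<^sub>R x - T x))"
    and pb: "\<And>n x. norm ((A ^^ n) x) \<le> norm x"
  shows "(\<forall>e>0. \<exists>N. \<forall>m\<ge>N. \<forall>n\<ge>N. \<forall>x. norm ((A ^^ m) x - (A ^^ n) x) \<le> e * norm x)
    \<longleftrightarrow> spectrum T \<subseteq> Omega \<alpha> \<omega>" (is "?Cauchy \<longleftrightarrow> ?spec")
proof
  assume Cauchy: ?Cauchy
  show ?spec
  proof (rule subsetI, rule ccontr)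
    fix \<zeta> assume "\<zeta> \<in> spectrum T" and "\<zeta> \<notin> Omega \<alpha> \<omega>"
    then have not_bij: "\<not> bij (\<lambda>x. \<zeta> *\<^sub>C x - T x)" and ne: "\<zeta> \<noteq> of_real \<omega>"
      and le: "cmod (1 - of_real \<alpha> * \<zeta>) \<le> cmod (of_real c)"
      by (simp_all add: spectrum_iff_not_bij[OF T(2)] Omega_iff[OF \<alpha>(1)] not_less)
    define d where "d = 1 - of_real \<alpha> * \<zeta>"
    show False
    proof (cases "d = 0")
      case True
      \<comment> \<open>The point \<open>\<zeta> = 1 / \<alpha>\<close> corresponds to \<mu> at
        infinity; there \<open>\<zeta> - T\<close> is a multiple of the bijection
        \<open>G'\<close>.\<close>
      have "\<zeta> *\<^sub>C x - T x = of_real (c / \<alpha>) *\<^sub>C G' x" for x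
      proof -
        have "\<zeta> = of_real (inverse \<alpha>)" using True \<alpha>(1) by (simp add: d_def field_simps)
        then have "\<zeta> *\<^sub>C x - T x = inverse \<alpha> *\<^sub>R x - T x" by (simp only: scaleC_of_real)
        also have "\<dots> = inverse \<alpha> *\<^sub>R (x - \<alpha> *\<^sub>R T x)" using \<alpha>(1) by (simp add: scaleR_diff_right)
        also have "\<dots> = of_real (c / \<alpha>) *\<^sub>C G' x"
          unfolding scaleC_of_real using c_nonzero \<alpha>(1) by (simp add: divide_inverse)
        finally show ?thesis .
      qed
      moreover have "bij (\<lambda>x. of_real (c / \<alpha>) *\<^sub>C G' x)"
        using bij_comp[OF bij_G' bij_scaleC[of "of_real (c / \<alpha>)"]] c_nonzero \<alpha>(1)
        by (simp add: o_def del: of_real_diff of_real_divide)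
      ultimately show False using not_bij by simp
    next
      case False
      define \<mu> where "\<mu> = of_real c / d"
      have "\<mu> \<noteq> 0" using False c_nonzero by (simp add: \<mu>_def del: of_real_diff)
      moreover have "of_real \<alpha> * \<zeta> = 1 - of_real c / \<mu>"
        using c_nonzero by (simp add: \<mu>_def d_def del: of_real_diff)
      moreover have "cmod d \<le> cmod (of_real c)" using le by (simp only: d_def)
      then have "cmod \<mu> \<ge> 1" using False by (simp add: \<mu>_def norm_divide field_simps del: of_real_diff)
      moreover have "\<mu> \<noteq> 1"
      proof
        assume "\<mu> = 1"
        then have "of_real c = d" using False by (simp add: \<mu>_def)
        then have "of_real \<alpha> * \<zeta> = of_real \<alpha> * of_real \<omega>" by (auto simp: d_def)
        then show False using ne \<alpha>(1) by simp
      qed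
      ultimately show False
        using bij_diff_A_iff bij_diff_of_Cauchy_powers[OF A(2)] Cauchy not_bij by blast
    qed
  qed
next
  assume spec: ?spec
  have "bij (\<lambda>x. \<mu> *\<^sub>C x - A x)" if \<mu>: "cmod \<mu> = 1" "\<mu> \<noteq> 1" for \<mu>
  proof -
    define \<zeta> where "\<zeta> = (1 - of_real c / \<mu>) / of_real \<alpha>"
    have "\<mu> \<noteq> 0" using \<mu> by auto
    have \<zeta>: "of_real \<alpha> * \<zeta> = 1 - of_real c / \<mu>"
      using \<alpha>(1) by (simp add: \<zeta>_def)
    have "cmod (1 - of_real \<alpha> * \<zeta>) = cmod (of_real c)"
      unfolding \<zeta> using \<mu> by (simp add: norm_divide)
    moreover have "\<zeta> \<noteq> of_real \<omega>"
    proof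
      assume "\<zeta> = of_real \<omega>"
      then have "of_real c = of_real c / \<mu>" using \<zeta> by (simp add: algebra_simps)
      then show False using c_nonzero \<mu> \<open>\<mu> \<noteq> 0\<close> by (simp add: field_simps del: of_real_diff)
    qed
    ultimately have "\<zeta> \<notin> Omega \<alpha> \<omega>" by (simp add: Omega_iff[OF \<alpha>(1)])
    then show ?thesis
      using spec bij_diff_A_iff[OF \<open>\<mu> \<noteq> 0\<close> \<zeta>] spectrum_iff_not_bij[OF T(2)] by blast
  qed
  then show ?Cauchy
    using Cauchy_powers_of_direct_sum[OF A(2) pb] sum by (simp add: range_diff_A_eq kernel_diff_A_eq)
qed

end

end

theorem theorem1p10:
  fixes h :: "'a::complex_banach \<Rightarrow> 'a" and \<alpha> \<omega> :: real
  assumes "h \<in> Hol unit_ball UNIV"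
    and "h 0 = 0"
    and "is_direct_sum
           (kernel (\<lambda>x. \<omega> *\<^sub>R x - frechet_derivative h (at 0) x))
           (range (\<lambda>x. \<omega> *\<^sub>R x - frechet_derivative h (at 0) x))"
    and "\<alpha> \<noteq> 0"
    and "\<alpha> * \<omega> \<noteq> 1"
    and "abel_average_defined h \<alpha> \<omega>"
    and "abel_average h \<alpha> \<omega> \<in> Hol unit_ball unit_ball"
  shows "((\<exists>\<phi>. converges_inside_ball (\<lambda>n. abel_average h \<alpha> \<omega> ^^ n) \<phi>)
           \<longleftrightarrow> spectrum (frechet_derivative h (at 0)) \<subseteq> Omega \<alpha> \<omega>) \<and>
         (\<forall>\<phi>. converges_inside_ball (\<lambda>n. abel_average h \<alpha> \<omega> ^^ n) \<phi>
           \<longrightarrow> holomorphic_retraction \<phi> (Null h \<omega>))"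
proof -
  note hyps = assms(1,2,4-7)
  let ?F = "abel_average h \<alpha> \<omega>"
  obtain A where A: "(?F has_derivative A) (at 0)" "bounded_clinear A"
    and inv: "\<And>v. A (inverse (1 - \<alpha> * \<omega>) *\<^sub>R (v - \<alpha> *\<^sub>R frechet_derivative h (at 0) v)) = v"
      "\<And>v. inverse (1 - \<alpha> * \<omega>) *\<^sub>R (A v - \<alpha> *\<^sub>R frechet_derivative h (at 0) (A v)) = v"
    using abel_average_derivative[OF hyps] by blast
  note F = assms(7) abel_average_zero[OF hyps] A
  have "(\<exists>\<phi>. converges_inside_ball (\<lambda>n. ?F ^^ n) \<phi>) \<longleftrightarrow>
      (\<forall>e>0. \<exists>N. \<forall>m\<ge>N. \<forall>n\<ge>N. \<forall>x. norm ((A ^^ m) x - (A ^^ n) x) \<le> e * norm x)"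
    using funpow_converges_inside_ball[OF F] Cauchy_powers_of_converges_inside_ball[OF F] by blast
  also have "\<dots> \<longleftrightarrow> spectrum (frechet_derivative h (at 0)) \<subseteq> Omega \<alpha> \<omega>"
    by (rule Cauchy_powers_iff_spectrum[OF hyps A inv assms(3) norm_funpow_derivative_le[OF F]])
  finally show ?thesis
    using limit_holomorphic_retraction[OF F] abel_average_fixed_points[OF hyps] by simp
qed

end
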